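(* Consider a mean field game with finite state space $\mathcal{S}$, finite action space $\mathcal{A}$, transition rates $Q_{ija}(m)$, rewards $r_{ia}(m)$ and discount factor $\beta\in(0,1)$ satisfying the standing assumptions in the context. Let $(\bar m,d)$ be a stationary mean field equilibrium such that $\mathcal{D}(\bar m)=\{d\}$. Let $O\supseteq\mathcal{P}(\mathcal{S})$ be an open subset of $\mathbb{R}^S$ such that $Q^d:O\to\mathbb{R}^{S\times S}$ is componentwise Lipschitz continuous, $Q^d(m)$ is a transition rate matrix for all $m\in\mathcal{P}(\mathcal{S})$, and the function $f^d:O\to\mathbb{R}^S$, $m\mapsto(Q^d(m))^Tm$, is continuously differentiable. Assume further that the Jacobian of $f^d$ at $\bar m$ has a zero eigenvalue with eigenvector $\bar m$ and all its other eigenvalues have strictly negative real parts. Then there is $\delta>0$ such that every trajectory $m$ of the myopic adjustment process with initial condition $m_0\in\mathcal{P}(\mathcal{S})$, $\|m_0-\bar m\|<\delta$, converges exponentially fast to $\bar m$, i.e. there are constants $C_1,C_2>0$ with $\|m(t)-\bar m\|\le C_1e^{-C_2t}$ for all $t\ge0$.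
   Context: $\mathcal{S}=\{1,\dots,S\}$ ($S>1$), $\mathcal{A}=\{1,\dots,A\}$, $\mathcal{P}(\mathcal{S})$ the probability simplex in $\mathbb{R}^S$. For each $a$ and $m$, $(Q_{ija}(m))_{i,j}$ is a conservative generator; $m\mapsto Q_{ija}(m)$ is Lipschitz and $m\mapsto r_{ia}(m)$ continuous on $\mathcal{P}(\mathcal{S})$. A (mixed) stationary strategy is $\pi:\mathcal{S}\to\mathcal{P}(\mathcal{A})$; a deterministic stationary strategy is a map $d:\mathcal{S}\to\mathcal{A}$, identified with $d_{ia}=1$ if $d(i)=a$ and $0$ otherwise. For a strategy $\pi$, $Q^\pi(m)_{ij}=\sum_aQ_{ija}(m)\pi_{ia}$; in particular $Q^d(m)_{ij}=Q_{ijd(i)}(m)$. Given a flow $m:[0,\infty)\to\mathcal{P}(\mathcal{S})$ and strategy $\pi$, an agent's state is a Markov process with generator $Q^\pi(m(t))$ and receives expected discounted reward $\mathbb{E}[\int_0^\infty\sum_a r_{X_t a}(m(t))\pi_{X_ta}(t)e^{-\beta t}dt]$. A stationary mean field equilibrium is a pair $(\bar m,\pi)$ with $\bar m\in\mathcal{P}(\mathcal{S})$ and $\pi$ stationary such that $(Q^\pi(\bar m))^T\bar m=0$ (the law of the agent's process started in $\bar m$ stays $\bar m$ against the constant flow $\bar m$) and, for every initial distribution, $\pi$ maximizes the expected discounted reward among all (possibly time-dependent, mixed) strategies against the constant flow $\bar m$. For fixed $m$, $V^\ast(m)$ is the unique solution of $\beta V_i=\max_a\{r_{ia}(m)+\sum_jQ_{ija}(m)V_j\}$,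 $O_i(m)=\operatorname{argmax}_a\{r_{ia}(m)+\sum_jQ_{ija}(m)V^\ast_j(m)\}$, $\mathcal{D}(m)=\{d:\mathcal{S}\to\mathcal{A}: d(i)\in O_i(m)\ \forall i\}$. Let $F(m)=\operatorname{conv}\{(\sum_{i,a}m_iQ_{ija}(m)d_{ia})_{j\in\mathcal{S}}: d\in\mathcal{D}(m)\}$. A trajectory of the myopic adjustment process with initial condition $m_0$ is an absolutely continuous $m:[0,\infty)\to\mathcal{P}(\mathcal{S})$ with $m(0)=m_0$ and $\dot m(t)\in F(m(t))$ for almost all $t\ge0$. *)

theory Defs
  imports "HOL-Analysis.Analysis" "HOL-Computational_Algebra.Polynomial"
begin

text \<open>States are the elements of a finite type 's, actions the elements of a finite type 'a.
  Distributions / vectors in R^S are elements of real^'s.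
  Q i j a m is the rate Q_{ija}(m), r i a m the reward r_{ia}(m).\<close>

definition prob_simplex :: "(real^'s::finite) set" where
  "prob_simplex = {m. (\<forall>i. 0 \<le> m$i) \<and> (\<Sum>i\<in>UNIV. m$i) = 1}"

definition is_prob_on :: "('a::finite \<Rightarrow> real) \<Rightarrow> bool" where
  "is_prob_on p \<longleftrightarrow> (\<forall>a. 0 \<le> p a) \<and> (\<Sum>a\<in>UNIV. p a) = 1"

definition is_strategy :: "('s::finite \<Rightarrow> 'a::finite \<Rightarrow> real) \<Rightarrow> bool" where
  "is_strategy stg \<longleftrightarrow> (\<forall>i. is_prob_on (stg i))"

definition det_strat :: "('s \<Rightarrow> 'a) \<Rightarrow> 's \<Rightarrow> 'a \<Rightarrow> real" where
  "det_strat d i a = (if d i = a then 1 else 0)"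

definition is_generator :: "('s::finite \<Rightarrow> 's \<Rightarrow> real) \<Rightarrow> bool" where
  "is_generator G \<longleftrightarrow> (\<forall>i j. i \<noteq> j \<longrightarrow> 0 \<le> G i j) \<and> (\<forall>i. (\<Sum>j\<in>UNIV. G i j) = 0)"

definition Qpi :: "('s \<Rightarrow> 's \<Rightarrow> 'a::finite \<Rightarrow> real^'s \<Rightarrow> real) \<Rightarrow> ('s \<Rightarrow> 'a \<Rightarrow> real)
    \<Rightarrow> real^'s \<Rightarrow> 's \<Rightarrow> 's \<Rightarrow> real" where
  "Qpi Q stg m i j = (\<Sum>a\<in>UNIV. Q i j a m * stg i a)"

definition flowvec :: "('s::finite \<Rightarrow> 's \<Rightarrow> real) \<Rightarrow> real^'s \<Rightarrow> real^'s" where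
  "flowvec G v = (\<chi> j. \<Sum>i\<in>UNIV. v$i * G i j)"

definition standing_assms :: "('s::finite \<Rightarrow> 's \<Rightarrow> 'a::finite \<Rightarrow> real^'s \<Rightarrow> real)
    \<Rightarrow> ('s \<Rightarrow> 'a \<Rightarrow> real^'s \<Rightarrow> real) \<Rightarrow> real \<Rightarrow> bool" where
  "standing_assms Q r \<beta> \<longleftrightarrow>
     CARD('s) > 1 \<and> 0 < \<beta> \<and> \<beta> < 1 \<and>
     (\<forall>a. \<forall>m\<in>prob_simplex. is_generator (\<lambda>i j. Q i j a m)) \<and>
     (\<forall>i j a. \<exists>L. L-lipschitz_on prob_simplex (Q i j a)) \<and>
     (\<forall>i a. continuous_on prob_simplex (r i a))"

text \<open>Optimal value V*(m): the unique solution of the Bellman equation.\<close>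
definition Vstar :: "('s::finite \<Rightarrow> 's \<Rightarrow> 'a::finite \<Rightarrow> real^'s \<Rightarrow> real)
    \<Rightarrow> ('s \<Rightarrow> 'a \<Rightarrow> real^'s \<Rightarrow> real) \<Rightarrow> real \<Rightarrow> real^'s \<Rightarrow> real^'s" where
  "Vstar Q r \<beta> m = (THE V. \<forall>i. \<beta> * V$i =
       Max (range (\<lambda>a. r i a m + (\<Sum>j\<in>UNIV. Q i j a m * V$j))))"

definition Oset :: "('s::finite \<Rightarrow> 's \<Rightarrow> 'a::finite \<Rightarrow> real^'s \<Rightarrow> real)
    \<Rightarrow> ('s \<Rightarrow> 'a \<Rightarrow> real^'s \<Rightarrow> real) \<Rightarrow> real \<Rightarrow> real^'s \<Rightarrow> 's \<Rightarrow> 'a set" where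
  "Oset Q r \<beta> m i =
     (let g = (\<lambda>a. r i a m + (\<Sum>j\<in>UNIV. Q i j a m * Vstar Q r \<beta> m $ j))
      in {a. g a = Max (range g)})"

definition Dset :: "('s::finite \<Rightarrow> 's \<Rightarrow> 'a::finite \<Rightarrow> real^'s \<Rightarrow> real)
    \<Rightarrow> ('s \<Rightarrow> 'a \<Rightarrow> real^'s \<Rightarrow> real) \<Rightarrow> real \<Rightarrow> real^'s \<Rightarrow> ('s \<Rightarrow> 'a) set" where
  "Dset Q r \<beta> m = {d. \<forall>i. d i \<in> Oset Q r \<beta> m i}"

definition Fmap :: "('s::finite \<Rightarrow> 's \<Rightarrow> 'a::finite \<Rightarrow> real^'s \<Rightarrow> real)
    \<Rightarrow> ('s \<Rightarrow> 'a \<Rightarrow> real^'s \<Rightarrow> real) \<Rightarrow> real \<Rightarrow> real^'s \<Rightarrow> (real^'s) set" where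
  "Fmap Q r \<beta> m = convex hull
     ((\<lambda>d. \<chi> j. \<Sum>i\<in>UNIV. \<Sum>a\<in>UNIV. m$i * Q i j a m * det_strat d i a) ` Dset Q r \<beta> m)"

definition abs_continuous_on_interval :: "real \<Rightarrow> real \<Rightarrow> (real \<Rightarrow> 'b::real_normed_vector) \<Rightarrow> bool" where
  "abs_continuous_on_interval a b f \<longleftrightarrow>
     (\<forall>\<epsilon>>0. \<exists>\<delta>>0. \<forall>(n::nat) (u::nat \<Rightarrow> real) v.
        (\<forall>k<n. a \<le> u k \<and> u k \<le> v k \<and> v k \<le> b) \<and>
        (\<forall>k<n. \<forall>l<n. k \<noteq> l \<longrightarrow> v k \<le> u l \<or> v l \<le> u k) \<and>
        (\<Sum>k<n. v k - u k) < \<delta>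
        \<longrightarrow> (\<Sum>k<n. norm (f (v k) - f (u k))) < \<epsilon>)"

text \<open>Trajectory of the myopic adjustment process with initial condition m0
  (absolute continuity on [0,infinity) read as absolute continuity on every [0,T]).\<close>
definition myopic_trajectory :: "('s::finite \<Rightarrow> 's \<Rightarrow> 'a::finite \<Rightarrow> real^'s \<Rightarrow> real)
    \<Rightarrow> ('s \<Rightarrow> 'a \<Rightarrow> real^'s \<Rightarrow> real) \<Rightarrow> real \<Rightarrow> real^'s \<Rightarrow> (real \<Rightarrow> real^'s) \<Rightarrow> bool" where
  "myopic_trajectory Q r \<beta> m0 m \<longleftrightarrow>
     (\<forall>T\<ge>0. abs_continuous_on_interval 0 T m) \<and>
     (\<forall>t\<ge>0. m t \<in> prob_simplex) \<and> m 0 = m0 \<and>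
     (AE t in lborel. 0 \<le> t \<longrightarrow>
        (\<exists>v. (m has_vector_derivative v) (at t) \<and> v \<in> Fmap Q r \<beta> (m t)))"

definition admissible_strategy :: "(real \<Rightarrow> 's::finite \<Rightarrow> 'a::finite \<Rightarrow> real) \<Rightarrow> bool" where
  "admissible_strategy \<sigma> \<longleftrightarrow>
     (\<forall>t\<ge>0. is_strategy (\<sigma> t)) \<and> (\<forall>i a. (\<lambda>t. \<sigma> t i a) \<in> borel_measurable lborel)"

text \<open>p is the law (time-marginal distribution) of the agent's state process with generator
  Q^{sigma(t)}(mbar) and initial distribution p0: Kolmogorov forward equation in integral form.\<close>
definition is_law :: "('s::finite \<Rightarrow> 's \<Rightarrow> 'a::finite \<Rightarrow> real^'s \<Rightarrow> real) \<Rightarrow> real^'s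
    \<Rightarrow> (real \<Rightarrow> 's \<Rightarrow> 'a \<Rightarrow> real) \<Rightarrow> real^'s \<Rightarrow> (real \<Rightarrow> real^'s) \<Rightarrow> bool" where
  "is_law Q mbar \<sigma> p0 p \<longleftrightarrow>
     (\<forall>t\<ge>0. ((\<lambda>s. flowvec (Qpi Q (\<sigma> s) mbar) (p s)) has_integral (p t - p0)) {0..t})"

text \<open>Expected discounted reward E[int_0^infty sum_a r_{X_t a}(mbar) sigma_{X_t a}(t) e^{-beta t} dt],
  written via the law p of X_t.\<close>
definition exp_reward :: "('s::finite \<Rightarrow> 'a::finite \<Rightarrow> real^'s \<Rightarrow> real) \<Rightarrow> real \<Rightarrow> real^'s
    \<Rightarrow> (real \<Rightarrow> 's \<Rightarrow> 'a \<Rightarrow> real) \<Rightarrow> (real \<Rightarrow> real^'s) \<Rightarrow> real" where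
  "exp_reward r \<beta> mbar \<sigma> p =
     integral {0..} (\<lambda>t. (\<Sum>i\<in>UNIV. p t $ i * (\<Sum>a\<in>UNIV. r i a mbar * \<sigma> t i a)) * exp (- \<beta> * t))"

definition stationary_mfe :: "('s::finite \<Rightarrow> 's \<Rightarrow> 'a::finite \<Rightarrow> real^'s \<Rightarrow> real)
    \<Rightarrow> ('s \<Rightarrow> 'a \<Rightarrow> real^'s \<Rightarrow> real) \<Rightarrow> real \<Rightarrow> real^'s \<Rightarrow> ('s \<Rightarrow> 'a \<Rightarrow> real) \<Rightarrow> bool" where
  "stationary_mfe Q r \<beta> mbar stg \<longleftrightarrow>
     mbar \<in> prob_simplex \<and> is_strategy stg \<and>
     flowvec (Qpi Q stg mbar) mbar = 0 \<and>
     (\<forall>p0\<in>prob_simplex. \<forall>\<sigma> p q.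
        admissible_strategy \<sigma> \<and> is_law Q mbar \<sigma> p0 p \<and> is_law Q mbar (\<lambda>_. stg) p0 q
        \<longrightarrow> exp_reward r \<beta> mbar \<sigma> p \<le> exp_reward r \<beta> mbar (\<lambda>_. stg) q)"

definition char_poly :: "real^'n^'n \<Rightarrow> complex poly" where
  "char_poly J = det (\<chi> i j. (if i = j then [:0, 1:] else 0) - [: complex_of_real (J$i$j) :])"

end

theory Submission
  imports Defs "HOL-Computational_Algebra.Fundamental_Theorem_Algebra"
begin

text \<open>The optimal value \<open>V\<^sup>*(m)\<close> depends continuously on \<open>m\<close> by the maximum principle for the Bellman
  equation, so the strict optimality of \<open>d\<close> at the equilibrium persists nearby and there the
  differential inclusion is the differential equation \<open>m' = f\<^sup>d(m)\<close>. Its right-hand side is tangent to the simplex,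
  and on the tangent space, the vectors of sum zero, the Jacobian agrees with a Hurwitz matrix \<open>A\<close>.
  Triangularising the dual of \<open>A\<close> over the complex numbers gives a quadratic form \<open>b\<close> that decreases
  along \<open>A\<close>; the map \<open>t \<mapsto> exp (2 c t) b (m t - mbar) (m t - mbar)\<close> is then absolutely continuous with
  a.e. nonpositive derivative as long as the trajectory is close to the equilibrium, which makes it stay close.\<close>

section \<open>Absolutely continuous functions\<close>

text \<open>Trajectories are only absolutely continuous and solve an ordinary equation only near
  \<open>mbar\<close>, which may lie on the boundary of the simplex. So the form is tested along the
  given trajectory at almost every time, rather than along a flow, and tangency is read off from
  one-sided derivatives along segments inside the simplex. The zero eigenvalue does no harm because
  its eigenvector has coordinate sum 1, while displacements within the simplex have sum zero;
  algebraic simplicity is what keeps 0 from occurring a second time on the tangent space. The form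
  is a weighted sum of squared moduli of linear functionals, on which a matrix acts by its
  transpose. Since \<open>A\<close> may fail to be diagonalisable, the functionals are only
  triangularised: along \<open>A\<close>, each one reproduces itself with a factor \<open>z\<close>,
  \<open>Re z < 0\<close>, up to a combination of earlier ones. Large weights on the earlier ones
  absorb that remainder.\<close>

lemma abs_continuousE:
  assumes "abs_continuous_on_interval a b f" and "\<epsilon> > 0"
  obtains \<delta> where "\<delta> > 0" and "\<And>(n::nat) u v.
        (\<forall>k<n. a \<le> u k \<and> u k \<le> v k \<and> v k \<le> b) \<Longrightarrow>
        (\<forall>k<n. \<forall>l<n. k \<noteq> l \<longrightarrow> v k \<le> u l \<or> v l \<le> u k) \<Longrightarrow>
        (\<Sum>k<n. v k - u k) < \<delta> \<Longrightarrow> (\<Sum>k<n. norm (f (v k) - f (u k))) < \<epsilon>"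
proof -
  from spec[OF assms(1)[unfolded abs_continuous_on_interval_def], THEN mp, OF assms(2)]
  obtain \<delta> where \<delta>: "\<delta> > 0" "\<forall>(n::nat) u v.
        (\<forall>k<n. a \<le> u k \<and> u k \<le> v k \<and> v k \<le> b) \<and>
        (\<forall>k<n. \<forall>l<n. k \<noteq> l \<longrightarrow> v k \<le> u l \<or> v l \<le> u k) \<and>
        (\<Sum>k<n. v k - u k) < \<delta> \<longrightarrow> (\<Sum>k<n. norm (f (v k) - f (u k))) < \<epsilon>"
    by (elim exE conjE)
  show thesis
    by (rule that[OF \<delta>(1)], rule \<delta>(2)[THEN spec, THEN spec, THEN spec, THEN mp])
      (intro conjI; assumption)
qed

text \<open>Gauge argument: in a fine tagged division the intervals with tag outside \<open>N\<close> contribute little by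
  the sign of the derivative; those with tag in \<open>N\<close> have small total length, because the indicator of
  \<open>N\<close> has Henstock--Kurzweil integral zero, and contribute little by absolute continuity.\<close>

lemma abs_continuous_nonincreasing:
  fixes g :: "real \<Rightarrow> real"
  assumes "a \<le> b" and ac: "abs_continuous_on_interval a b g" and N: "negligible N"
    and der: "\<And>t. t \<in> {a..b} - N \<Longrightarrow> \<exists>D\<le>0. (g has_real_derivative D) (at t)"
  shows "g b \<le> g a"
proof (rule field_le_epsilon)
  fix e0 :: real assume "e0 > 0"
  \<comment> \<open>Intervals tagged outside \<open>N\<close> will cost at most
    \<open>e * (b - a)\<close>, those tagged in \<open>N\<close> at most \<open>e\<close>; together
    this is \<open>e0\<close>.\<close>
  define e where "e = e0 / (b - a + 1)"
  have e: "e > 0" using \<open>e0 > 0\<close> \<open>a \<le> b\<close> by (simp add: e_def)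
  obtain \<delta> where "\<delta> > 0" and \<delta>: "\<And>(n::nat) u v.
        (\<forall>k<n. a \<le> u k \<and> u k \<le> v k \<and> v k \<le> b) \<Longrightarrow>
        (\<forall>k<n. \<forall>l<n. k \<noteq> l \<longrightarrow> v k \<le> u l \<or> v l \<le> u k) \<Longrightarrow>
        (\<Sum>k<n. v k - u k) < \<delta> \<Longrightarrow> (\<Sum>k<n. norm (g (v k) - g (u k))) < e"
    using abs_continuousE[OF ac e] by blast
  have "(indicat_real N has_integral 0) (cbox a b)"
    using N unfolding negligible_def by blast
  then obtain \<gamma>1 where \<gamma>1: "gauge \<gamma>1" and small: "\<And>p. p tagged_division_of (cbox a b) \<Longrightarrow> \<gamma>1 fine p \<Longrightarrow>
       norm ((\<Sum>(x,K)\<in>p. measure lborel K *\<^sub>R indicat_real N x) - 0) < \<delta>"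
    unfolding has_integral[of _ 0] using \<open>\<delta> > 0\<close> by metis
  \<comment> \<open>The condition on \<open>t\<close> sits inside the existential, so that choice
    yields a positive radius at every point, as a gauge requires. The bound compares points on
    either side of \<open>t\<close>, since a tag is only somewhere in its interval.\<close>
  have "\<exists>\<eta>>0. t \<in> {a..b} - N \<longrightarrow>
          (\<forall>u v. u \<le> t \<longrightarrow> t \<le> v \<longrightarrow> t - u < \<eta> \<longrightarrow> v - t < \<eta> \<longrightarrow> g v - g u \<le> e * (v - u))" for t
  proof (cases "t \<in> {a..b} - N")
    case True
    then obtain D where D: "D \<le> 0" "(g has_real_derivative D) (at t)" using der by blast
    then have "(g has_derivative (*) D) (at t)" by (simp add: has_field_derivative_def)
    then obtain \<eta> where \<eta>: "\<eta> > 0"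
        "\<And>y. norm (y - t) < \<eta> \<Longrightarrow> norm (g y - g t - D * (y - t)) \<le> e * norm (y - t)"
      unfolding has_derivative_at_alt using e by meson
    have "g v - g u \<le> e * (v - u)" if "u \<le> t" "t \<le> v" "t - u < \<eta>" "v - t < \<eta>" for u v
    proof -
      have "g v - g t - D * (v - t) \<le> e * (v - t)" using \<eta>(2)[of v] that by auto
      moreover have "g t - g u + D * (u - t) \<le> e * (t - u)" using \<eta>(2)[of u] that by auto
      moreover have "D * (v - t) \<le> 0" "D * (u - t) \<ge> 0"
        using that D(1) by (simp_all add: mult_nonpos_nonneg mult_nonpos_nonpos)
      ultimately show ?thesis by (simp add: algebra_simps)
    qed
    then show ?thesis using \<eta>(1) by blast
  qed (use zero_less_one in blast)
  then obtain \<eta> where \<eta>: "\<And>t. \<eta> t > 0" and straddle: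
     "\<And>t u v. t \<in> {a..b} - N \<Longrightarrow> u \<le> t \<Longrightarrow> t \<le> v \<Longrightarrow> t - u < \<eta> t \<Longrightarrow> v - t < \<eta> t \<Longrightarrow> g v - g u \<le> e * (v - u)"
    by metis
  have "gauge (\<lambda>t. \<gamma>1 t \<inter> ball t (\<eta> t))"
    using \<gamma>1 \<eta> by (intro gauge_Int gauge_ball_dependent) auto
  then obtain p where p: "p tagged_division_of {a..b}" and fine: "(\<lambda>t. \<gamma>1 t \<inter> ball t (\<eta> t)) fine p"
    using fine_division_exists_real by blast
  have "\<gamma>1 fine p" using fine by (simp add: fine_Int)
  have finp: "finite p" using p by blast
  have ivl: "\<exists>c d. K = {c..d} \<and> c \<le> x \<and> x \<le> d \<and> a \<le> c \<and> d \<le> b" if mem: "(x, K) \<in> p" for x K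
  proof -
    obtain c d where "K = {c..d}" using tagged_division_ofD(4)[OF p mem] by auto
    then show ?thesis using tagged_division_ofD(2,3)[OF p mem] by auto
  qed
  \<comment> \<open>Degenerate intervals are left out: they contribute nothing, and for them
    disjoint interiors would not give the ordering that absolute continuity asks for.\<close>
  define p1 where "p1 = {z \<in> p. fst z \<in> N \<and> measure lborel (snd z) \<noteq> 0}"
  have p1p: "p1 \<subseteq> p" by (auto simp: p1_def)
  then have finp1: "finite p1" using finp finite_subset by blast
  obtain h where h: "bij_betw h {..<card p1} p1"
    using ex_bij_betw_nat_finite[OF finp1] by (auto simp: atLeast0LessThan)
  define u where "u k = Inf (snd (h k))" for k
  define v where "v k = Sup (snd (h k))" for k
  have hk: "\<exists>x. h k = (x, {u k..v k}) \<and> a \<le> u k \<and> u k < v k \<and> v k \<le> b" if "k < card p1" for k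
  proof -
    have hp: "h k \<in> p1" using h that bij_betwE by blast
    obtain x K where xK: "h k = (x, K)" by (cases "h k")
    then obtain c d where cd: "K = {c..d}" "c \<le> d" "a \<le> c" "d \<le> b" using ivl[of x K] hp p1p by fastforce
    then show ?thesis using xK hp by (auto simp: u_def v_def p1_def)
  qed
  have sumh: "(\<Sum>k<card p1. F (v k) (u k)) = (\<Sum>(x,K)\<in>p1. F (Sup K) (Inf K))" for F :: "real \<Rightarrow> real \<Rightarrow> real"
    unfolding u_def v_def using sum.reindex_bij_betw[OF h, of "\<lambda>z. F (Sup (snd z)) (Inf (snd z))"]
    by (simp add: case_prod_beta)
  have "(\<Sum>k<card p1. norm (g (v k) - g (u k))) < e"
  proof (rule \<delta>)
    show "\<forall>k<card p1. a \<le> u k \<and> u k \<le> v k \<and> v k \<le> b" using hk by fastforce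
    show "\<forall>k<card p1. \<forall>l<card p1. k \<noteq> l \<longrightarrow> v k \<le> u l \<or> v l \<le> u k"
    proof (intro allI impI)
      fix k l assume kl: "k < card p1" "l < card p1" "k \<noteq> l"
      obtain x y where x: "h k = (x, {u k..v k})" "u k < v k" and y: "h l = (y, {u l..v l})" "u l < v l"
        using hk kl by meson
      have "h k \<noteq> h l" using h kl unfolding bij_betw_def inj_on_def by auto
      moreover have "h k \<in> p" "h l \<in> p" using h kl p1p bij_betwE by blast+
      ultimately have "interior {u k..v k} \<inter> interior {u l..v l} = {}"
        using tagged_division_ofD(5)[OF p, of x "{u k..v k}" y "{u l..v l}"] x y by auto
      then have disj: "{u k<..<v k} \<inter> {u l<..<v l} = {}" by (simp add: interior_atLeastAtMost_real)
      show "v k \<le> u l \<or> v l \<le> u k"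
      proof (rule ccontr)
        assume "\<not> ?thesis"
        then have "max (u k) (u l) < min (v k) (v l)" using x y by auto
        then obtain z where "max (u k) (u l) < z" "z < min (v k) (v l)" using dense by blast
        then have "z \<in> {u k<..<v k} \<inter> {u l<..<v l}" by auto
        then show False using disj by blast
      qed
    qed
    have "(\<Sum>k<card p1. v k - u k) = (\<Sum>(x,K)\<in>p1. Sup K - Inf K)" by (rule sumh)
    also have "\<dots> = (\<Sum>(x,K)\<in>p1. measure lborel K *\<^sub>R indicat_real N x)"
    proof (rule sum.cong)
      fix z assume z: "z \<in> p1"
      obtain x K where xK: "z = (x, K)" by (cases z)
      then obtain c d where "K = {c..d}" "c \<le> d" using ivl[of x K] z p1p by fastforce
      then show "(case z of (x,K) \<Rightarrow> Sup K - Inf K) = (case z of (x,K) \<Rightarrow> measure lborel K *\<^sub>R indicat_real N x)"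
        using xK z by (auto simp: p1_def)
    qed simp
    also have "\<dots> \<le> (\<Sum>(x,K)\<in>p. measure lborel K *\<^sub>R indicat_real N x)"
      by (rule sum_mono2[OF finp p1p]) (auto simp: case_prod_beta)
    also have "\<dots> < \<delta>" using small[OF _ \<open>\<gamma>1 fine p\<close>] p by auto
    finally show "(\<Sum>k<card p1. v k - u k) < \<delta>" .
  qed
  then have bad: "(\<Sum>(x,K)\<in>p1. \<bar>g (Sup K) - g (Inf K)\<bar>) < e" by (simp add: sumh[of "\<lambda>s t. \<bar>g s - g t\<bar>"])
  have good: "g (Sup K) - g (Inf K) \<le> e * (Sup K - Inf K)" if "(x,K) \<in> p" "(x,K) \<notin> p1" for x K
  proof -
    obtain c d where cd: "K = {c..d}" "c \<le> x" "x \<le> d" "a \<le> c" "d \<le> b" using ivl[OF \<open>(x,K) \<in> p\<close>] by blast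
    show ?thesis
    proof (cases "x \<in> N")
      case True
      then have "c = d" using that cd by (auto simp: p1_def)
      then show ?thesis using cd by simp
    next
      case False
      have "K \<subseteq> ball x (\<eta> x)" using fine that(1) unfolding fine_def by fastforce
      then have "c \<in> ball x (\<eta> x)" "d \<in> ball x (\<eta> x)" using cd by (meson atLeastAtMost_iff order_refl order_trans subsetD)+
      then have "g d - g c \<le> e * (d - c)" using straddle[of x c d] cd False by (auto simp: dist_real_def)
      then show ?thesis using cd by simp
    qed
  qed
  have "g b - g a = (\<Sum>(x,K)\<in>p. g (Sup K) - g (Inf K))"
    using additive_tagged_division_1[OF \<open>a \<le> b\<close> p, of g] by simp
  also have "\<dots> = (\<Sum>(x,K)\<in>p - p1. g (Sup K) - g (Inf K)) + (\<Sum>(x,K)\<in>p1. g (Sup K) - g (Inf K))"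
    by (rule sum.subset_diff[OF p1p finp])
  also have "(\<Sum>(x,K)\<in>p - p1. g (Sup K) - g (Inf K)) \<le> (\<Sum>(x,K)\<in>p - p1. e * (Sup K - Inf K))"
    by (rule sum_mono) (use good in auto)
  also have "\<dots> \<le> (\<Sum>(x,K)\<in>p. e * (Sup K - Inf K))"
  proof (rule sum_mono2[OF finp])
    fix z assume "z \<in> p - (p - p1)"
    then obtain x K where "z = (x,K)" "(x,K) \<in> p" by (cases z) auto
    then show "0 \<le> (case z of (x,K) \<Rightarrow> e * (Sup K - Inf K))" using ivl[of x K] e by fastforce
  qed auto
  also have "\<dots> = e * (b - a)"
    using additive_tagged_division_1[OF \<open>a \<le> b\<close> p, of "\<lambda>x. x"]
    by (simp add: sum_distrib_left[symmetric] case_prod_beta)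
  also have "(\<Sum>(x,K)\<in>p1. g (Sup K) - g (Inf K)) \<le> (\<Sum>(x,K)\<in>p1. \<bar>g (Sup K) - g (Inf K)\<bar>)"
    by (rule sum_mono) auto
  also note bad
  finally have "g b - g a < e * (b - a) + e" by simp
  also have "\<dots> = e * (b - a + 1)" by (simp add: algebra_simps)
  also have "\<dots> = e0" using \<open>a \<le> b\<close> by (simp add: e_def)
  finally show "g b \<le> g a + e0" by simp
qed

lemma abs_continuous_imp_continuous_on:
  assumes "abs_continuous_on_interval a b f"
  shows "continuous_on {a..b} f"
proof (rule continuous_onI)
  fix x and \<epsilon> :: real assume x: "x \<in> {a..b}" and "\<epsilon> > 0"
  obtain \<delta> where "\<delta> > 0" and \<delta>: "\<And>(n::nat) u v.
        (\<forall>k<n. a \<le> u k \<and> u k \<le> v k \<and> v k \<le> b) \<Longrightarrow>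
        (\<forall>k<n. \<forall>l<n. k \<noteq> l \<longrightarrow> v k \<le> u l \<or> v l \<le> u k) \<Longrightarrow>
        (\<Sum>k<n. v k - u k) < \<delta> \<Longrightarrow> (\<Sum>k<n. norm (f (v k) - f (u k))) < \<epsilon>"
    using abs_continuousE[OF assms \<open>\<epsilon> > 0\<close>] by blast
  have "dist (f y) (f x) \<le> \<epsilon>" if "y \<in> {a..b}" "dist y x < \<delta>" for y
    using \<delta>[of 1 "\<lambda>_. min x y" "\<lambda>_. max x y"] x that
    by (cases "x \<le> y") (auto simp: dist_norm norm_minus_commute)
  then show "\<exists>d>0. \<forall>x'\<in>{a..b}. dist x' x < d \<longrightarrow> dist (f x') (f x) \<le> \<epsilon>"
    using \<open>\<delta> > 0\<close> by blast
qed

text \<open>The Lyapunov function depends on time through the trajectory and through an exponential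
  factor; the summand \<open>\<bar>t - s\<bar>\<close> accounts for the latter.\<close>

lemma abs_continuous_dominated:
  fixes f :: "real \<Rightarrow> 'b::real_normed_vector" and h :: "real \<Rightarrow> 'c::real_normed_vector"
  assumes f: "abs_continuous_on_interval a b f" and "K > 0"
    and dom: "\<And>s t. s \<in> {a..b} \<Longrightarrow> t \<in> {a..b} \<Longrightarrow> norm (h t - h s) \<le> K * (\<bar>t - s\<bar> + norm (f t - f s))"
  shows "abs_continuous_on_interval a b h"
  unfolding abs_continuous_on_interval_def
proof (intro allI impI)
  fix \<epsilon> :: real assume "\<epsilon> > 0"
  then have "\<epsilon> / (2 * K) > 0" using \<open>K > 0\<close> by simp
  then obtain \<delta> where "\<delta> > 0" and \<delta>: "\<And>(n::nat) u v.
        (\<forall>k<n. a \<le> u k \<and> u k \<le> v k \<and> v k \<le> b) \<Longrightarrow>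
        (\<forall>k<n. \<forall>l<n. k \<noteq> l \<longrightarrow> v k \<le> u l \<or> v l \<le> u k) \<Longrightarrow>
        (\<Sum>k<n. v k - u k) < \<delta> \<Longrightarrow> (\<Sum>k<n. norm (f (v k) - f (u k))) < \<epsilon> / (2 * K)"
    using abs_continuousE[OF f] by blast
  show "\<exists>\<delta>>0. \<forall>(n::nat) u v.
        (\<forall>k<n. a \<le> u k \<and> u k \<le> v k \<and> v k \<le> b) \<and>
        (\<forall>k<n. \<forall>l<n. k \<noteq> l \<longrightarrow> v k \<le> u l \<or> v l \<le> u k) \<and>
        (\<Sum>k<n. v k - u k) < \<delta> \<longrightarrow> (\<Sum>k<n. norm (h (v k) - h (u k))) < \<epsilon>"
  proof (intro exI[of _ "min \<delta> (\<epsilon> / (2 * K))"] conjI allI impI)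
    fix n :: nat and u v :: "nat \<Rightarrow> real"
    assume *: "(\<forall>k<n. a \<le> u k \<and> u k \<le> v k \<and> v k \<le> b) \<and>
        (\<forall>k<n. \<forall>l<n. k \<noteq> l \<longrightarrow> v k \<le> u l \<or> v l \<le> u k) \<and>
        (\<Sum>k<n. v k - u k) < min \<delta> (\<epsilon> / (2 * K))"
    have "(\<Sum>k<n. norm (h (v k) - h (u k))) \<le> (\<Sum>k<n. K * ((v k - u k) + norm (f (v k) - f (u k))))"
    proof (rule sum_mono)
      fix k assume "k \<in> {..<n}"
      then have "a \<le> u k" "u k \<le> v k" "v k \<le> b" using * by auto
      then show "norm (h (v k) - h (u k)) \<le> K * ((v k - u k) + norm (f (v k) - f (u k)))"
        using dom[of "u k" "v k"] by simp
    qed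
    also have "\<dots> = K * ((\<Sum>k<n. v k - u k) + (\<Sum>k<n. norm (f (v k) - f (u k))))"
      by (simp add: sum_distrib_left sum.distrib distrib_left)
    also have "\<dots> < K * (\<epsilon> / (2 * K) + \<epsilon> / (2 * K))"
      using \<delta>[of n u v] * \<open>K > 0\<close> by (intro mult_strict_left_mono add_strict_mono) auto
    also have "\<dots> = \<epsilon>" using \<open>K > 0\<close> by (simp add: field_simps)
    finally show "(\<Sum>k<n. norm (h (v k) - h (u k))) < \<epsilon>" .
  qed (use \<open>\<delta> > 0\<close> \<open>\<epsilon> / (2 * K) > 0\<close> in auto)
qed

section \<open>The Bellman equation\<close>

lemma Max_range_diff_le:
  fixes f g :: "'a::finite \<Rightarrow> real"
  assumes "\<And>a. \<bar>f a - g a\<bar> \<le> e"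
  shows "\<bar>Max (range f) - Max (range g)\<bar> \<le> e"
proof -
  have *: "Max (range f') \<le> Max (range g') + e" if "\<And>a. f' a \<le> g' a + e" for f' g' :: "'a \<Rightarrow> real"
  proof (rule Max.boundedI)
    fix x assume "x \<in> range f'"
    then obtain a where "x = f' a" by blast
    then have "x \<le> g' a + e" using that by simp
    also have "g' a \<le> Max (range g')" by simp
    finally show "x \<le> Max (range g') + e" by simp
  qed auto
  have "f a \<le> g a + e" "g a \<le> f a + e" for a using assms[of a] by linarith+
  from *[of f g, OF this(1)] *[of g f, OF this(2)] show ?thesis by linarith
qed

lemma Max_range_attained:
  fixes f :: "'a::finite \<Rightarrow> real"
  obtains a where "Max (range f) = f a"
proof -
  have "Max (range f) \<in> range f" by (rule Max_in) auto
  then show thesis using that by blast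
qed

lemma continuous_on_Max_range:
  fixes f :: "'a::finite \<Rightarrow> 'b::metric_space \<Rightarrow> real"
  assumes "\<And>a. continuous_on S (f a)"
  shows "continuous_on S (\<lambda>x. Max (range (\<lambda>a. f a x)))"
proof (rule continuous_onI)
  fix x and e :: real assume "x \<in> S" and "0 < e"
  have "\<forall>\<^sub>F y in at x within S. \<forall>a. dist (f a y) (f a x) < e"
    using assms \<open>x \<in> S\<close> \<open>0 < e\<close> by (intro eventually_all_finite) (auto simp: continuous_on tendsto_iff)
  then obtain d where "d > 0" and d: "\<And>y. y \<in> S \<Longrightarrow> y \<noteq> x \<Longrightarrow> dist y x < d \<Longrightarrow> (\<forall>a. dist (f a y) (f a x) < e)"
    unfolding eventually_at by blast
  have "dist (Max (range (\<lambda>a. f a y))) (Max (range (\<lambda>a. f a x))) \<le> e" if "y \<in> S" "dist y x < d" for y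
    unfolding dist_real_def using d[OF that(1) _ that(2)] \<open>0 < e\<close>
    by (intro Max_range_diff_le) (cases "y = x", auto simp: dist_real_def less_imp_le)
  then show "\<exists>d>0. \<forall>y\<in>S. dist y x < d \<longrightarrow> dist (Max (range (\<lambda>a. f a y))) (Max (range (\<lambda>a. f a x))) \<le> e"
    using \<open>d > 0\<close> by blast
qed

text \<open>Rates and rewards are frozen, independently of the value vector, so that the optimal
  value at one population can be tested in the Bellman equation of another.\<close>

definition action_value :: "('s::finite \<Rightarrow> 's \<Rightarrow> 'a \<Rightarrow> real) \<Rightarrow> ('s \<Rightarrow> 'a \<Rightarrow> real) \<Rightarrow> real^'s \<Rightarrow> 's \<Rightarrow> 'a \<Rightarrow> real"
  where "action_value G R V i a = R i a + (\<Sum>j\<in>UNIV. G i j a * V$j)"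

definition bellman_sol :: "('s::finite \<Rightarrow> 's \<Rightarrow> 'a::finite \<Rightarrow> real) \<Rightarrow> ('s \<Rightarrow> 'a \<Rightarrow> real) \<Rightarrow> real \<Rightarrow> real^'s \<Rightarrow> bool"
  where "bellman_sol G R \<beta> V \<longleftrightarrow> (\<forall>i. \<beta> * V$i = Max (range (action_value G R V i)))"

text \<open>Off-diagonal entries are nonnegative, so replacing each \<open>w j\<close> by the
  largest value \<open>w i\<close> can only raise the sum, and a row of \<open>G\<close> sums to
  zero.\<close>

lemma generator_maximum_principle:
  assumes "is_generator G" and "\<And>j. w j \<le> w i"
  shows "(\<Sum>j\<in>UNIV. G i j * w j) \<le> 0"
proof -
  have "(\<Sum>j\<in>UNIV. G i j * w j) \<le> (\<Sum>j\<in>UNIV. G i j * w i)"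
  proof (rule sum_mono)
    fix j show "G i j * w j \<le> G i j * w i"
      using assms unfolding is_generator_def by (cases "i = j") (auto intro: mult_left_mono)
  qed
  also have "\<dots> = 0" using assms(1) by (simp add: is_generator_def sum_distrib_right[symmetric])
  finally show ?thesis .
qed

text \<open>Where \<open>V - W\<close> is largest, an action optimal for \<open>V\<close> is used in
  both equations; the maximum principle removes the generator term and leaves
  \<open>\<beta> * (V$k - W$k) \<le> e\<close>. Where it is smallest, an action optimal for
  \<open>W\<close> does the same. The case \<open>e = 0\<close> is uniqueness; general
  \<open>e\<close> gives continuity in the population.\<close>

lemma bellman_residual_bound:
  fixes G :: "'s::finite \<Rightarrow> 's \<Rightarrow> 'a::finite \<Rightarrow> real"
  assumes gen: "\<And>a. is_generator (\<lambda>i j. G i j a)" and "\<beta> > 0"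
    and V: "bellman_sol G R \<beta> V"
    and res: "\<And>i. \<bar>\<beta> * W$i - Max (range (action_value G R W i))\<bar> \<le> e"
  shows "\<bar>V$i - W$i\<bar> \<le> e / \<beta>"
proof -
  have fin: "finite (range (\<lambda>i. V$i - W$i))" and ne: "range (\<lambda>i. V$i - W$i) \<noteq> {}" by auto
  have diff: "action_value G R V i a - action_value G R W i a = (\<Sum>j\<in>UNIV. G i j a * (V$j - W$j))" for i a
    by (simp add: action_value_def sum_subtractf right_diff_distrib)
  obtain k where k: "\<And>j. V$j - W$j \<le> V$k - W$k"
    using Max_in[OF fin ne] Max_ge[OF fin] by (metis (mono_tags, lifting) rangeE rangeI)
  obtain l where l: "\<And>j. V$l - W$l \<le> V$j - W$j"
    using Min_in[OF fin ne] Min_le[OF fin] by (metis (mono_tags, lifting) rangeE rangeI)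
  obtain a where a: "\<beta> * V$k = action_value G R V k a"
    using Max_range_attained[of "action_value G R V k"] V unfolding bellman_sol_def by metis
  have "action_value G R V k a - action_value G R W k a \<le> 0"
    unfolding diff using gen k by (intro generator_maximum_principle[where G="\<lambda>i j. G i j a"]) auto
  moreover have "action_value G R W k a \<le> Max (range (action_value G R W k))" by simp
  ultimately have kbound: "\<beta> * (V$k - W$k) \<le> e" unfolding right_diff_distrib using a res[of k] by linarith
  obtain b where b: "Max (range (action_value G R W l)) = action_value G R W l b"
    by (rule Max_range_attained)
  have "(\<Sum>j\<in>UNIV. G l j b * (- (V$j - W$j))) \<le> 0"
  proof (rule generator_maximum_principle)
    show "- (V$j - W$j) \<le> - (V$l - W$l)" for j using l[of j] by linarith
  qed (rule gen)
  then have "action_value G R V l b - action_value G R W l b \<ge> 0"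
    unfolding diff by (simp add: sum_negf sum_subtractf algebra_simps)
  moreover have "action_value G R V l b \<le> \<beta> * V$l" using V by (simp add: bellman_sol_def)
  ultimately have "\<beta> * (W$l - V$l) \<le> e" unfolding right_diff_distrib using b res[of l] by linarith
  with kbound have "V$k - W$k \<le> e / \<beta>" "W$l - V$l \<le> e / \<beta>"
    using \<open>\<beta> > 0\<close> by (simp_all add: field_simps)
  then show ?thesis using k[of i] l[of i] by linarith
qed

lemma bellman_sol_unique:
  fixes G :: "'s::finite \<Rightarrow> 's \<Rightarrow> 'a::finite \<Rightarrow> real"
  assumes "\<And>a. is_generator (\<lambda>i j. G i j a)" "\<beta> > 0" "bellman_sol G R \<beta> V" "bellman_sol G R \<beta> W"
  shows "V = W"
  using bellman_residual_bound[OF assms(1-3), of W 0] assms(4) by (simp add: bellman_sol_def vec_eq_iff)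

text \<open>Uniformisation: adding \<open>\<theta> * V $ i\<close> on both sides with \<open>\<theta>\<close> larger than all exit rates
  turns the Bellman equation into a fixed point equation for a continuous self-map of a cube.\<close>

lemma bellman_sol_exists:
  fixes G :: "'s::finite \<Rightarrow> 's \<Rightarrow> 'a::finite \<Rightarrow> real" and R :: "'s \<Rightarrow> 'a \<Rightarrow> real"
  assumes gen: "\<And>a. is_generator (\<lambda>i j. G i j a)" and "\<beta> > 0"
  shows "\<exists>V. bellman_sol G R \<beta> V"
proof -
  define \<theta> where "\<theta> = Max (range (\<lambda>(i, a). \<bar>G i i a\<bar>))"
  define \<rho> where "\<rho> = Max (range (\<lambda>(i, a). \<bar>R i a\<bar>))"
  have lam: "\<bar>G i i a\<bar> \<le> \<theta>" for i a
    unfolding \<theta>_def by (rule Max_ge) (auto intro: range_eqI[of _ _ "(i,a)"])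
  have rho: "\<bar>R i a\<bar> \<le> \<rho>" for i a
    unfolding \<rho>_def by (rule Max_ge) (auto intro: range_eqI[of _ _ "(i,a)"])
  have lam0: "\<theta> \<ge> 0" using lam abs_ge_zero order_trans by blast
  have rho0: "\<rho> \<ge> 0" using rho abs_ge_zero order_trans by blast
  \<comment> \<open>Chosen so that \<open>\<rho> + \<theta> * B = (\<beta> + \<theta>) * B\<close>,
    which makes the cube of radius \<open>B\<close> invariant under \<open>T\<close>.\<close>
  define B where "B = \<rho> / \<beta>"
  have B0: "B \<ge> 0" using rho0 \<open>\<beta> > 0\<close> by (simp add: B_def)
  define T :: "real^'s \<Rightarrow> real^'s"
    where "T V = (\<chi> i. Max (range (\<lambda>a. action_value G R V i a + \<theta> * V$i)) / (\<beta> + \<theta>))" for V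
  have bl: "\<beta> + \<theta> > 0" using \<open>\<beta> > 0\<close> lam0 by simp
  define S :: "(real^'s) set" where "S = cbox (\<chi> i. - B) (\<chi> i. B)"
  have memS: "V \<in> S \<longleftrightarrow> (\<forall>i. \<bar>V$i\<bar> \<le> B)" for V
    by (auto simp: S_def mem_box_cart abs_le_iff minus_le_iff)
  have bound: "\<bar>action_value G R V i a + \<theta> * V$i\<bar> \<le> (\<beta> + \<theta>) * B" if "V \<in> S" for V i a
  proof -
    \<comment> \<open>Adding \<open>\<theta>\<close> on the diagonal makes all weights nonnegative,
      with sum \<open>\<theta>\<close>.\<close>
    define c where "c j = G i j a + (if j = i then \<theta> else 0)" for j
    have c0: "c j \<ge> 0" for j
      using gen[of a] lam[of i a] unfolding c_def is_generator_def by (cases "j = i") auto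
    have csum: "(\<Sum>j\<in>UNIV. c j) = \<theta>"
      using gen[of a] unfolding c_def is_generator_def by (simp add: sum.distrib)
    have "(\<Sum>j\<in>UNIV. c j * V$j) = (\<Sum>j\<in>UNIV. G i j a * V$j + (if j = i then \<theta> * V$j else 0))"
      by (rule sum.cong) (auto simp: c_def distrib_right)
    then have "action_value G R V i a + \<theta> * V$i = R i a + (\<Sum>j\<in>UNIV. c j * V$j)"
      by (simp add: action_value_def sum.distrib)
    also have "\<bar>\<dots>\<bar> \<le> \<bar>R i a\<bar> + (\<Sum>j\<in>UNIV. \<bar>c j * V$j\<bar>)"
      by (rule order_trans[OF abs_triangle_ineq add_left_mono[OF sum_abs]])
    also have "(\<Sum>j\<in>UNIV. \<bar>c j * V$j\<bar>) \<le> (\<Sum>j\<in>UNIV. c j * B)"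
      using that c0 by (intro sum_mono) (auto simp: abs_mult memS intro: mult_left_mono)
    also have "\<dots> = \<theta> * B" by (simp add: sum_distrib_right[symmetric] csum)
    also have "\<bar>R i a\<bar> \<le> \<beta> * B" using rho \<open>\<beta> > 0\<close> by (simp add: B_def)
    finally show ?thesis by (simp add: distrib_right)
  qed
  have "continuous_on S T"
    unfolding T_def action_value_def
    by (intro continuous_intros continuous_on_vec_lambda continuous_on_Max_range) (use bl in auto)
  moreover have "T \<in> S \<rightarrow> S"
  proof
    fix V assume "V \<in> S"
    have "\<bar>Max (range (\<lambda>a. action_value G R V i a + \<theta> * V$i))\<bar> \<le> (\<beta> + \<theta>) * B" for i
      using Max_range_diff_le[of "\<lambda>a. action_value G R V i a + \<theta> * V$i" "\<lambda>_. 0"] bound[OF \<open>V \<in> S\<close>]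
      by simp
    then show "T V \<in> S" using bl by (simp add: memS T_def abs_divide divide_le_eq mult.commute)
  qed
  moreover have "S \<noteq> {}" using memS[of 0] B0 by auto
  ultimately obtain V where V: "V \<in> S" "T V = V"
    using brouwer[of S T] unfolding S_def by (metis compact_cbox convex_box(1))
  have "\<beta> * V$i = Max (range (action_value G R V i))" for i
  proof -
    have "(\<beta> + \<theta>) * V$i = Max (range (\<lambda>a. action_value G R V i a + \<theta> * V$i))"
      using V(2) bl by (simp add: T_def vec_eq_iff field_simps)
    also have "\<dots> = Max (range (action_value G R V i)) + \<theta> * V$i"
      using Max_add_commute[of UNIV "action_value G R V i" "\<theta> * V$i"] by simp
    finally show ?thesis by (simp add: distrib_right)
  qed
  then show ?thesis unfolding bellman_sol_def by blast
qed

section \<open>Optimal strategies as the population varies\<close>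

context
  fixes Q :: "'s::finite \<Rightarrow> 's \<Rightarrow> 'a::finite \<Rightarrow> real^'s \<Rightarrow> real"
    and r :: "'s \<Rightarrow> 'a \<Rightarrow> real^'s \<Rightarrow> real" and \<beta> :: real
  assumes std: "standing_assms Q r \<beta>"
begin

lemma generator_rates: "m \<in> prob_simplex \<Longrightarrow> is_generator (\<lambda>i j. Q i j a m)"
  using std by (simp add: standing_assms_def)

lemma discount_pos: "\<beta> > 0"
  using std by (simp add: standing_assms_def)

lemma continuous_on_rates: "continuous_on prob_simplex (Q i j a)"
  using std unfolding standing_assms_def by (meson lipschitz_on_continuous_on)

lemma continuous_on_rewards: "continuous_on prob_simplex (r i a)"
  using std by (simp add: standing_assms_def)

lemma Vstar_bellman_sol:
  assumes m: "m \<in> prob_simplex"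
  shows "bellman_sol (\<lambda>i j a. Q i j a m) (\<lambda>i a. r i a m) \<beta> (Vstar Q r \<beta> m)"
proof -
  let ?P = "bellman_sol (\<lambda>i j a. Q i j a m) (\<lambda>i a. r i a m) \<beta>"
  have "\<exists>!V. ?P V"
    using bellman_sol_exists[of "\<lambda>i j a. Q i j a m" \<beta>] bellman_sol_unique[of "\<lambda>i j a. Q i j a m" \<beta>]
      generator_rates[OF m] discount_pos by metis
  then have "?P (THE V. ?P V)" by (rule theI')
  then show ?thesis by (simp add: Vstar_def bellman_sol_def action_value_def[abs_def])
qed

lemma Oset_eq:
  "Oset Q r \<beta> m i = {a. action_value (\<lambda>i j a. Q i j a m) (\<lambda>i a. r i a m) (Vstar Q r \<beta> m) i a
     = Max (range (action_value (\<lambda>i j a. Q i j a m) (\<lambda>i a. r i a m) (Vstar Q r \<beta> m) i))}"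
  by (simp add: Oset_def action_value_def[abs_def])

lemma Oset_nonempty: "Oset Q r \<beta> m i \<noteq> {}"
  using Max_range_attained[of "action_value (\<lambda>i j a. Q i j a m) (\<lambda>i a. r i a m) (Vstar Q r \<beta> m) i"]
  unfolding Oset_eq by (metis (mono_tags, lifting) empty_iff mem_Collect_eq)

text \<open>The value at \<open>x\<close> is kept fixed and inserted in the Bellman equation at
  \<open>m\<close>. Its residual is continuous in \<open>m\<close> and vanishes at
  \<open>m = x\<close>, and \<open>bellman_residual_bound\<close> lets it control the change of the
  value.\<close>

lemma continuous_on_Vstar: "continuous_on prob_simplex (Vstar Q r \<beta>)"
  unfolding continuous_on
proof
  fix x :: "real^'s" assume x: "x \<in> prob_simplex"
  let ?F = "at x within prob_simplex"
  let ?W = "Vstar Q r \<beta> x"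
  define res where "res m i = \<beta> * ?W$i - Max (range (\<lambda>a. action_value (\<lambda>i j a. Q i j a m) (\<lambda>i a. r i a m) ?W i a))" for m i
  define tot where "tot m = (\<Sum>i\<in>UNIV. \<bar>res m i\<bar>)" for m
  have "continuous_on prob_simplex tot"
    unfolding tot_def res_def action_value_def
    by (intro continuous_intros continuous_on_Max_range continuous_on_rates continuous_on_rewards)
  moreover have "tot x = 0"
    using Vstar_bellman_sol[OF x] by (simp add: tot_def res_def bellman_sol_def)
  ultimately have tot: "(tot \<longlongrightarrow> 0) ?F" using x by (auto simp: continuous_on)
  have bd: "\<bar>Vstar Q r \<beta> m $ i - ?W $ i\<bar> \<le> tot m / \<beta>" if m: "m \<in> prob_simplex" for m i
  proof (rule bellman_residual_bound[OF _ discount_pos Vstar_bellman_sol[OF m]])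
    show "is_generator (\<lambda>i j. Q i j a m)" for a using generator_rates[OF m] .
    show "\<bar>\<beta> * ?W $ i - Max (range (action_value (\<lambda>i j a. Q i j a m) (\<lambda>i a. r i a m) ?W i))\<bar> \<le> tot m" for i
      using member_le_sum[of i UNIV "\<lambda>i. \<bar>res m i\<bar>"] by (simp add: tot_def res_def)
  qed
  show "(Vstar Q r \<beta> \<longlongrightarrow> ?W) ?F"
  proof (rule vec_tendstoI, rule LIM_zero_cancel, rule Lim_null_comparison)
    fix i
    show "\<forall>\<^sub>F m in ?F. norm (Vstar Q r \<beta> m $ i - ?W $ i) \<le> tot m / \<beta>"
      using bd by (auto simp: eventually_at_filter)
    show "((\<lambda>m. tot m / \<beta>) \<longlongrightarrow> 0) ?F"
      using tendsto_divide_zero[OF tot] .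
  qed
qed

text \<open>Finitely many strict inequalities between continuous action values persist near
  \<open>x\<close>.\<close>

lemma eventually_Dset_eq:
  assumes "x \<in> prob_simplex" and uniq: "Dset Q r \<beta> x = {d}"
  shows "\<forall>\<^sub>F m in at x within prob_simplex. Dset Q r \<beta> m = {d}"
proof -
  define av where "av m = action_value (\<lambda>i j a. Q i j a m) (\<lambda>i a. r i a m) (Vstar Q r \<beta> m)" for m
  have opt: "Oset Q r \<beta> x i = {d i}" for i
  proof -
    have di: "d i \<in> Oset Q r \<beta> x i" for i using uniq unfolding Dset_def by blast
    have "a = d i" if a: "a \<in> Oset Q r \<beta> x i" for a
    proof -
      \<comment> \<open>Changing \<open>d\<close> in a single state to another optimal action would
        give a second element of \<open>Dset\<close>, so a unique strategy means a unique optimal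
        action in every state.\<close>
      have "d(i := a) \<in> Dset Q r \<beta> x" using di a by (simp add: Dset_def)
      then have "d(i := a) = d" using uniq by blast
      then show ?thesis by (metis fun_upd_same)
    qed
    then show ?thesis using di by blast
  qed
  have gap: "av x i a < av x i (d i)" if "a \<noteq> d i" for i a
  proof -
    have "av x i a \<le> Max (range (av x i))" by simp
    moreover have "av x i a \<noteq> Max (range (av x i))" "av x i (d i) = Max (range (av x i))"
      using opt[of i] that unfolding Oset_eq av_def by blast+
    ultimately show ?thesis by (metis order_le_less)
  qed
  have cont: "continuous_on prob_simplex (\<lambda>m. av m i a)" for i a
    unfolding av_def action_value_def
    by (intro continuous_intros continuous_on_rates continuous_on_rewards continuous_on_component continuous_on_Vstar)
  have "\<forall>\<^sub>F m in at x within prob_simplex. \<forall>i a. a \<noteq> d i \<longrightarrow> av m i a < av m i (d i)"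
  proof (intro eventually_all_finite)
    fix i a
    have "((\<lambda>m. av m i (d i) - av m i a) \<longlongrightarrow> av x i (d i) - av x i a) (at x within prob_simplex)"
      using cont[of i a] cont[of i "d i"] assms(1) by (intro tendsto_diff) (auto simp: continuous_on)
    then have "a \<noteq> d i \<Longrightarrow> \<forall>\<^sub>F m in at x within prob_simplex. 0 < av m i (d i) - av m i a"
      using gap[of a i] by (intro order_tendstoD(1)) auto
    then show "\<forall>\<^sub>F m in at x within prob_simplex. a \<noteq> d i \<longrightarrow> av m i a < av m i (d i)"
      by (cases "a = d i") auto
  qed
  then show ?thesis
  proof eventually_elim
    case (elim m)
    have "Oset Q r \<beta> m i = {d i}" for i
    proof -
      have "a = d i" if "a \<in> Oset Q r \<beta> m i" for a
      proof (rule ccontr)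
        assume "a \<noteq> d i"
        then have "av m i a < av m i (d i)" using elim by blast
        also have "\<dots> \<le> Max (range (av m i))" by simp
        finally show False using that by (simp add: Oset_eq av_def)
      qed
      then show ?thesis using Oset_nonempty[of m i] by blast
    qed
    then show ?case by (auto simp: Dset_def fun_eq_iff)
  qed
qed

end

lemma Fmap_singleton:
  assumes "Dset Q r \<beta> m = {d}"
  shows "Fmap Q r \<beta> m = {flowvec (\<lambda>i j. Q i j (d i) m) m}"
  by (simp add: Fmap_def assms flowvec_def det_strat_def if_distrib[of "(*) _"] cong: if_cong)

section \<open>Lyapunov forms of Hurwitz matrices\<close>

text \<open>Here \<open>w\<close> stands for a linear functional. There is no conjugation, so the
  pairing is complex linear in \<open>w\<close> and \<open>A\<close> acts on functionals through the
  plain transpose, whose eigenvalues are those of \<open>A\<close>.\<close>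

definition cpair :: "complex^'n \<Rightarrow> real^'n \<Rightarrow> complex" where
  "cpair w v = (\<Sum>j\<in>UNIV. w$j * of_real (v$j))"

definition cmat :: "real^'n^'m \<Rightarrow> complex^'n^'m" where
  "cmat A = (\<chi> i j. of_real (A$i$j))"

lemma cpair_add_left: "cpair (w + w') v = cpair w v + cpair w' v"
  by (simp add: cpair_def distrib_right sum.distrib)

lemma cpair_scale_left: "cpair (a *s w) v = a * cpair w v"
  by (simp add: cpair_def sum_distrib_left mult.assoc)

lemma linear_cpair: "linear (cpair w)"
  by (rule linearI)
    (simp_all add: cpair_def distrib_left sum.distrib scaleR_sum_right, simp add: scaleR_conv_of_real mult.left_commute)

lemma cpair_transpose: "cpair (transpose (cmat A) *v w) v = cpair w (A *v v)"
proof -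
  have "cpair (transpose (cmat A) *v w) v = (\<Sum>j\<in>UNIV. \<Sum>i\<in>UNIV. of_real (A$i$j) * w$i * of_real (v$j))"
    by (simp add: cpair_def matrix_vector_mult_def transpose_def cmat_def sum_distrib_right)
  also have "\<dots> = (\<Sum>i\<in>UNIV. \<Sum>j\<in>UNIV. of_real (A$i$j) * w$i * of_real (v$j))"
    by (rule sum.swap)
  also have "\<dots> = cpair w (A *v v)"
    by (simp add: cpair_def matrix_vector_mult_def sum_distrib_left mult_ac)
  finally show ?thesis .
qed

section \<open>Polynomials in a matrix and eigenvectors modulo a subspace\<close>

text \<open>The vector \<open>p(M) v\<close>, computed by Horner's scheme directly on
  vectors.\<close>

definition poly_mat_vec :: "'a::field^'n^'n \<Rightarrow> 'a poly \<Rightarrow> 'a^'n \<Rightarrow> 'a^'n" where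
  "poly_mat_vec M p v = fold_coeffs (\<lambda>a u. a *s v + M *v u) p 0"

lemma poly_mat_vec_0 [simp]: "poly_mat_vec M 0 v = 0"
  by (simp add: poly_mat_vec_def)

lemma poly_mat_vec_pCons [simp]: "poly_mat_vec M (pCons a p) v = a *s v + M *v poly_mat_vec M p v"
  by (cases "p = 0 \<and> a = 0") (auto simp: poly_mat_vec_def)

lemma poly_mat_vec_add: "poly_mat_vec M (p + q) v = poly_mat_vec M p v + poly_mat_vec M q v"
  by (induction p q rule: poly_induct2) (simp_all add: matrix_vector_right_distrib vec.scale_left_distrib)

lemma poly_mat_vec_smult: "poly_mat_vec M (smult a p) v = a *s poly_mat_vec M p v"
  by (induction p) (simp_all add: vec.scale_right_distrib vector_scalar_commute)

lemma poly_mat_vec_sum: "poly_mat_vec M (\<Sum>i\<in>I. p i) v = (\<Sum>i\<in>I. poly_mat_vec M (p i) v)"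
  by (induction I rule: infinite_finite_induct) (simp_all add: poly_mat_vec_add)

lemma poly_mat_vec_linear_factor:
  "poly_mat_vec M ([:- z, 1:] * p) v = M *v poly_mat_vec M p v - z *s poly_mat_vec M p v"
proof -
  have "[:- z, 1:] * p = smult (- z) p + pCons 0 p" by simp
  then show ?thesis by (simp only: poly_mat_vec_add poly_mat_vec_smult) simp
qed

text \<open>The \<open>CARD('n) + 1\<close> iterates \<open>v\<close>, \<open>M v\<close>,
  \<open>M (M v)\<close>, ... are linearly dependent, and the coefficients of a dependence form
  \<open>p\<close>.\<close>

lemma ex_annihilating_poly:
  fixes M :: "'a::field^'n^'n"
  shows "\<exists>p. p \<noteq> 0 \<and> poly_mat_vec M p v = 0"
\<comment> \<open>Dependence concerns the set of iterates, so two equal iterates are treated apart;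
  otherwise the enumeration is injective and the coefficients can be assigned to powers.\<close>
proof (cases "\<exists>i j. i < j \<and> poly_mat_vec M (monom 1 i) v = poly_mat_vec M (monom 1 j) v")
  case True
  then obtain i j where ij: "i < j" "poly_mat_vec M (monom 1 i) v = poly_mat_vec M (monom 1 j) v" by blast
  have "monom 1 j + smult (-1) (monom 1 i) \<noteq> (0 :: 'a poly)"
  proof
    assume "monom 1 j + smult (-1) (monom 1 i) = (0 :: 'a poly)"
    then have "coeff (monom 1 j + smult (-1) (monom 1 i)) j = (0 :: 'a)" by simp
    then show False using ij(1) by simp
  qed
  moreover have "poly_mat_vec M (monom 1 j + smult (-1) (monom 1 i)) v = 0"
    by (simp only: poly_mat_vec_add poly_mat_vec_smult ij(2)) simp
  ultimately show ?thesis by blast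
next
  case False
  define f where "f i = poly_mat_vec M (monom 1 i) v" for i :: nat
  have inj: "inj_on f {..CARD('n)}"
    using False unfolding f_def inj_on_def by (metis linorder_neqE_nat)
  have "vec.dependent (f ` {..CARD('n)})"
  proof (rule ccontr)
    assume "vec.independent (f ` {..CARD('n)})"
    then have "card (f ` {..CARD('n)}) \<le> vec.dim (UNIV :: ('a^'n) set)"
      by (intro vec.independent_card_le_dim) auto
    then show False by (simp add: card_image[OF inj] card_cart_basis)
  qed
  then obtain u where u: "\<exists>x\<in>f ` {..CARD('n)}. u x \<noteq> 0" "(\<Sum>x\<in>f ` {..CARD('n)}. u x *s x) = 0"
    by (auto simp: vec.dependent_finite)
  define p where "p = (\<Sum>i\<le>CARD('n). smult (u (f i)) (monom 1 i))"
  have "poly_mat_vec M p v = (\<Sum>i\<le>CARD('n). u (f i) *s f i)"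
    unfolding p_def poly_mat_vec_sum poly_mat_vec_smult f_def ..
  also have "\<dots> = 0" using u(2) by (simp add: sum.reindex[OF inj])
  finally have "poly_mat_vec M p v = 0" .
  moreover obtain i where i: "i \<le> CARD('n)" "u (f i) \<noteq> 0" using u(1) by auto
  have "coeff p i = u (f i)"
    using i(1) by (simp add: p_def coeff_sum if_distrib[of "(*) _"] cong: if_cong)
  then have "p \<noteq> 0" using i(2) by auto
  ultimately show ?thesis by blast
qed

text \<open>\<open>w\<close> represents an eigenvector on the quotient by \<open>W\<close>. A
  polynomial \<open>p\<close> with \<open>p(M) v\<close> in \<open>W\<close>, for some
  \<open>v\<close> outside \<open>W\<close>, is stripped of its linear factors one at a time; at
  some factor the vector \<open>q(M) v\<close> lies outside \<open>W\<close> although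
  \<open>M - z\<close> sends it into \<open>W\<close>.\<close>

lemma ex_quotient_eigenvector:
  fixes M :: "complex^'n^'n"
  assumes "vec.subspace W" and "W \<noteq> UNIV"
  obtains w z where "w \<notin> W" and "M *v w - z *s w \<in> W"
proof -
  obtain v where "v \<notin> W" using assms(2) by blast
  have *: "\<exists>w z. w \<notin> W \<and> M *v w - z *s w \<in> W" if "p \<noteq> 0" "poly_mat_vec M p v \<in> W" for p
    using that
  proof (induction "degree p" arbitrary: p)
    case 0
    then obtain a where "p = [:a:]" "a \<noteq> 0" by (metis degree_eq_zeroE pCons_0_0)
    then have "a *s v \<in> W" using 0 by simp
    then have "inverse a *s (a *s v) \<in> W" by (rule vec.subspace_scale[OF assms(1)])
    then show ?case using \<open>a \<noteq> 0\<close> \<open>v \<notin> W\<close> by (simp add: vec.scale_scale)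
  next
    case (Suc n)
    then have "\<not> constant (poly p)" by (simp add: constant_degree)
    then obtain z where "poly p z = 0" using fundamental_theorem_of_algebra by blast
    then obtain q where q: "p = [:- z, 1:] * q" by (metis dvdE poly_eq_0_iff_dvd)
    then have "q \<noteq> 0" using Suc.prems(1) by auto
    then have "degree p = Suc (degree q)" unfolding q by (subst degree_mult_eq) auto
    then have "degree q = n" using Suc.hyps(2) by simp
    show ?case
    proof (cases "poly_mat_vec M q v \<in> W")
      case True
      then show ?thesis using Suc.hyps(1) \<open>q \<noteq> 0\<close> \<open>degree q = n\<close> by blast
    next
      case False
      then show ?thesis using Suc.prems(2) unfolding q poly_mat_vec_linear_factor by blast
    qed
  qed
  obtain p where p: "p \<noteq> 0" "poly_mat_vec M p v = 0" using ex_annihilating_poly by blast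
  then have "poly_mat_vec M p v \<in> W" using vec.subspace_0[OF assms(1)] by simp
  then show thesis using * p(1) that by blast
qed

lemma matrix_diff_mat_mult:
  fixes M :: "'a::field^'n^'n"
  shows "(M - mat z) *v x = M *v x - z *s x"
  unfolding matrix_vector_mult_diff_rdistrib
  by (simp add: matrix_vector_mult_def mat_def vec_eq_iff if_distrib[of "\<lambda>y. y * a" for a] cong: if_cong)

text \<open>If \<open>M - z\<close> were injective, it would map the invariant \<open>W\<close> onto
  itself by dimension; then \<open>(M - z) w = (M - z) y\<close> for some \<open>y\<close> in
  \<open>W\<close>, which forces \<open>w = y\<close>.\<close>

lemma quotient_eigenvalue_imp_eigenvalue:
  fixes M :: "complex^'n^'n"
  assumes W: "vec.subspace W" "\<And>w. w \<in> W \<Longrightarrow> M *v w \<in> W"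
    and w: "w \<notin> W" "M *v w - z *s w \<in> W"
  shows "\<exists>x. x \<noteq> 0 \<and> M *v x = z *s x"
proof (rule ccontr)
  assume no: "\<not> ?thesis"
  note B = matrix_diff_mat_mult[of M z]
  have inj: "inj ((*v) (M - mat z))"
    unfolding vec.inj_iff_eq_0 B using no by auto
  have sub: "(*v) (M - mat z) ` W \<subseteq> W"
    using W unfolding B by (auto intro!: vec.subspace_diff vec.subspace_scale)
  have "vec.dim ((*v) (M - mat z) ` W) = vec.dim W"
    using inj by (intro vec.dim_image_eq) (auto intro: inj_on_subset)
  then have "(*v) (M - mat z) ` W = W"
    using sub W(1) by (intro vec.subspace_dim_equal vec.subspace_image) auto
  then obtain y where "y \<in> W" "(M - mat z) *v y = (M - mat z) *v w"
    using w(2) unfolding B by (metis (no_types, lifting) imageE B)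
  then show False using inj w(1) by (auto dest: injD)
qed

lemma eigenvalue_transpose:
  fixes M :: "'a::field^'n^'n"
  assumes "x \<noteq> 0" "transpose M *v x = z *s x"
  shows "\<exists>y. y \<noteq> 0 \<and> M *v y = z *s y"
proof -
  have ker: "(\<exists>y. y \<noteq> 0 \<and> N *v y = z *s y) \<longleftrightarrow> \<not> invertible (N - mat z)" for N :: "'a^'n^'n"
    unfolding invertible_left_inverse matrix_left_invertible_ker matrix_diff_mat_mult by auto
  have "transpose M - mat z = transpose (M - mat z)"
    by (simp add: transpose_def mat_def vec_eq_iff)
  then have "\<not> invertible (transpose (M - mat z))" using ker[of "transpose M"] assms by auto
  then have "\<not> invertible (M - mat z)" by (simp add: invertible_det_nz)
  then show ?thesis using ker by blast
qed

text \<open>Only positive semidefinite: a definite form is built up one functional \<open>cpair w\<close> at a time.\<close>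

definition lyapunov_form :: "real^'n^'n \<Rightarrow> (real^'n \<Rightarrow> real^'n \<Rightarrow> real) \<Rightarrow> bool" where
  "lyapunov_form A b \<longleftrightarrow> bilinear b \<and> (\<forall>u v. b u v = b v u) \<and> (\<forall>v. 0 \<le> b v v) \<and>
     (\<exists>c>0. \<forall>v. b v (A *v v) \<le> - c * b v v)"

text \<open>The constant may depend on \<open>w\<close>. With \<open>W = UNIV\<close> the coordinate
  functionals are dominated, which makes \<open>b\<close> definite.\<close>

definition dominates :: "(real^'n \<Rightarrow> real^'n \<Rightarrow> real) \<Rightarrow> (complex^'n) set \<Rightarrow> bool" where
  "dominates b W \<longleftrightarrow> (\<forall>w\<in>W. \<exists>K\<ge>0. \<forall>v. (cmod (cpair w v))\<^sup>2 \<le> K * b v v)"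

text \<open>The new form is \<open>N * b\<close> plus the squared modulus of the functional
  \<open>w\<close>. Along \<open>A\<close> that functional reproduces itself with factor
  \<open>z\<close> up to some \<open>u\<close> in \<open>W\<close>. Young's inequality splits the
  cross term: one part costs half the decay of \<open>w\<close>, the other is bounded by
  \<open>b\<close>, which dominates \<open>u\<close>.\<close>

lemma lyapunov_form_extend:
  fixes A :: "real^'n^'n"
  assumes b: "lyapunov_form A b" "dominates b W"
    and w: "transpose (cmat A) *v w - z *s w \<in> W" and z: "Re z < 0"
  obtains b' where "lyapunov_form A b'" and "dominates b' {a *s w + u | a u. u \<in> W}"
proof -
  define u where "u = transpose (cmat A) *v w - z *s w"
  from b(1) obtain c where bil: "bilinear b" and sym: "\<And>u v. b u v = b v u"
      and nn: "\<And>v. 0 \<le> b v v" and "c > 0" and c: "\<And>v. b v (A *v v) \<le> - c * b v v"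
    unfolding lyapunov_form_def by blast
  obtain K where "K \<ge> 0" and K: "\<And>v. (cmod (cpair u v))\<^sup>2 \<le> K * b v v"
    using b(2) w unfolding dominates_def u_def by blast
  define \<mu> where "\<mu> = - Re z"
  have "\<mu> > 0" using z by (simp add: \<mu>_def)
  \<comment> \<open>Young's inequality leaves \<open>K / (2*\<mu>) * b v v\<close>; half of the
    decay \<open>N * c\<close> of the old part must cover it, which means
    \<open>N \<ge> K / (\<mu> * c)\<close>. The extra 1 makes \<open>b'\<close> at least
    \<open>b\<close>.\<close>
  define N where "N = K / (\<mu> * c) + 1"
  have "N \<ge> 1" using \<open>K \<ge> 0\<close> \<open>\<mu> > 0\<close> \<open>c > 0\<close> by (simp add: N_def)
  \<comment> \<open>The second summand is the real symmetric bilinear form that polarises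
    \<open>(cmod (cpair w v))\<^sup>2\<close>.\<close>
  define b' where "b' x y = N * b x y + Re (cnj (cpair w x) * cpair w y)" for x y
  have b'vv: "b' v v = N * b v v + (cmod (cpair w v))\<^sup>2" for v
    unfolding b'_def by (simp add: cmod_power2) (simp add: power2_eq_square)
  have "bilinear b'"
    unfolding bilinear_def b'_def
    by (auto intro!: linearI simp: bilinear_ladd[OF bil] bilinear_radd[OF bil] bilinear_lmul[OF bil]
         bilinear_rmul[OF bil] linear_add[OF linear_cpair] linear_scale[OF linear_cpair] algebra_simps)
  moreover have "b' x y = b' y x" for x y
    by (simp add: b'_def sym[of x y] mult.commute)
  moreover have ge: "b v v \<le> b' v v" "(cmod (cpair w v))\<^sup>2 \<le> b' v v" for v
  proof -
    have "1 * b v v \<le> N * b v v" using \<open>N \<ge> 1\<close> nn by (intro mult_right_mono) auto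
    then show "b v v \<le> b' v v" "(cmod (cpair w v))\<^sup>2 \<le> b' v v"
      unfolding b'vv using nn[of v] by (simp_all add: add_increasing2 add_increasing)
  qed
  moreover have nn': "0 \<le> b' v v" for v using ge(1)[of v] nn[of v] by linarith
  moreover have "b' v (A *v v) \<le> - (min (c/2) (\<mu>/2)) * b' v v" for v
  proof -
    define s where "s = cmod (cpair w v)"
    define t where "t = cmod (cpair u v)"
    have "cpair w (A *v v) = z * cpair w v + cpair u v"
      using cpair_add_left[of "z *s w" u v]
      by (simp add: u_def cpair_scale_left flip: cpair_transpose)
    then have "cnj (cpair w v) * cpair w (A *v v) = z * of_real (s\<^sup>2) + cnj (cpair w v) * cpair u v"
      by (simp add: s_def algebra_simps complex_norm_square[symmetric] del: of_real_power)
    then have "Re (cnj (cpair w v) * cpair w (A *v v)) = - \<mu> * s\<^sup>2 + Re (cnj (cpair w v) * cpair u v)"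
      by (simp add: \<mu>_def)
    moreover have "Re (cnj (cpair w v) * cpair u v) \<le> s * t"
      using complex_Re_le_cmod[of "cnj (cpair w v) * cpair u v"] by (simp add: norm_mult s_def t_def)
    moreover have "s * t \<le> \<mu>/2 * s\<^sup>2 + K / (2*\<mu>) * b v v"
    proof -
      have "0 \<le> (\<mu> * s - t)\<^sup>2" by simp
      then have "2 * \<mu> * (s * t) \<le> \<mu>\<^sup>2 * s\<^sup>2 + t\<^sup>2" by (simp add: power2_diff power_mult_distrib algebra_simps)
      also have "t\<^sup>2 \<le> K * b v v" using K by (simp add: t_def)
      finally show ?thesis using \<open>\<mu> > 0\<close> by (simp add: field_simps power2_eq_square)
    qed
    moreover have "K / (2*\<mu>) * b v v \<le> (N * c / 2) * b v v"
    proof (rule mult_right_mono[OF _ nn])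
      show "K / (2*\<mu>) \<le> N * c / 2"
        using \<open>\<mu> > 0\<close> \<open>c > 0\<close> by (simp add: N_def field_simps)
    qed
    moreover have "N * b v (A *v v) \<le> N * (- c * b v v)"
      using c \<open>N \<ge> 1\<close> by (intro mult_left_mono) auto
    ultimately have "b' v (A *v v) \<le> - (c/2) * (N * b v v) - \<mu>/2 * s\<^sup>2"
      unfolding b'_def by (simp add: algebra_simps)
    also have "\<dots> \<le> - (min (c/2) (\<mu>/2)) * (N * b v v) - min (c/2) (\<mu>/2) * s\<^sup>2"
    proof -
      have "min (c/2) (\<mu>/2) * (N * b v v) \<le> (c/2) * (N * b v v)"
        using nn \<open>N \<ge> 1\<close> by (intro mult_right_mono) auto
      moreover have "min (c/2) (\<mu>/2) * s\<^sup>2 \<le> \<mu>/2 * s\<^sup>2" by (intro mult_right_mono) auto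
      ultimately show ?thesis by simp
    qed
    also have "\<dots> = - (min (c/2) (\<mu>/2)) * b' v v" unfolding b'vv s_def by (simp add: algebra_simps)
    finally show ?thesis .
  qed
  ultimately have L: "lyapunov_form A b'"
    unfolding lyapunov_form_def using \<open>c > 0\<close> \<open>\<mu> > 0\<close> by (intro conjI exI[of _ "min (c/2) (\<mu>/2)"]) auto
  have "dominates b' {a *s w + y | a y. y \<in> W}"
    unfolding dominates_def
  proof safe
    fix a y assume "y \<in> W"
    then obtain K where "K \<ge> 0" and K: "\<And>v. (cmod (cpair y v))\<^sup>2 \<le> K * b v v"
      using b(2) unfolding dominates_def by blast
    have "(cmod (cpair (a *s w + y) v))\<^sup>2 \<le> (2 * (cmod a)\<^sup>2 + 2 * K) * b' v v" for v
    proof -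
      have "cmod (cpair (a *s w + y) v) \<le> cmod a * cmod (cpair w v) + cmod (cpair y v)"
        unfolding cpair_add_left cpair_scale_left by (metis norm_mult norm_triangle_ineq)
      then have "(cmod (cpair (a *s w + y) v))\<^sup>2 \<le> (cmod a * cmod (cpair w v) + cmod (cpair y v))\<^sup>2"
        by (intro power_mono) auto
      also have "\<dots> \<le> 2 * (cmod a * cmod (cpair w v))\<^sup>2 + 2 * (cmod (cpair y v))\<^sup>2"
        unfolding power2_sum using sum_squares_bound[of "cmod a * cmod (cpair w v)" "cmod (cpair y v)"]
        by linarith
      also have "\<dots> \<le> 2 * ((cmod a)\<^sup>2 * b' v v) + 2 * (K * b' v v)"
      proof -
        have "K * b v v \<le> K * b' v v" using ge(1) \<open>K \<ge> 0\<close> by (intro mult_left_mono)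
        then have "(cmod (cpair y v))\<^sup>2 \<le> K * b' v v" using K[of v] by linarith
        moreover have "(cmod a)\<^sup>2 * (cmod (cpair w v))\<^sup>2 \<le> (cmod a)\<^sup>2 * b' v v"
          using ge(2) by (intro mult_left_mono) auto
        ultimately show ?thesis by (simp add: power_mult_distrib)
      qed
      finally show ?thesis by (simp add: algebra_simps)
    qed
    then show "\<exists>K\<ge>0. \<forall>v. (cmod (cpair (a *s w + y) v))\<^sup>2 \<le> K * b' v v"
      using \<open>K \<ge> 0\<close> by (intro exI[of _ "2 * (cmod a)\<^sup>2 + 2 * K"]) auto
  qed
  then show thesis using that L by blast
qed

text \<open>Starting from the zero form and \<open>{0}\<close>, an invariant subspace of the
  transpose whose functionals are dominated can be enlarged as long as it is proper: a quotient
  eigenvector exists, and its eigenvalue is one of the transpose, hence of \<open>A\<close>, so it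
  has negative real part. A subspace of greatest dimension of this kind is therefore
  everything.\<close>

lemma hurwitz_lyapunov_form:
  fixes A :: "real^'n^'n"
  assumes eig: "\<And>z x. x \<noteq> 0 \<Longrightarrow> cmat A *v x = z *s x \<Longrightarrow> Re z < 0"
  obtains b K where "lyapunov_form A b" and "K > 0" and "\<And>v. (norm v)\<^sup>2 \<le> K * b v v"
proof -
  define good where "good W \<longleftrightarrow> vec.subspace W \<and> (\<forall>w\<in>W. transpose (cmat A) *v w \<in> W) \<and>
      (\<exists>b. lyapunov_form A b \<and> dominates b W)" for W
  have step: "\<exists>W'. good W' \<and> vec.dim W < vec.dim W'" if "good W" "W \<noteq> UNIV" for W
  proof -
    from \<open>good W\<close> obtain b where W: "vec.subspace W" "\<And>w. w \<in> W \<Longrightarrow> transpose (cmat A) *v w \<in> W"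
        and b: "lyapunov_form A b" "dominates b W" unfolding good_def by blast
    obtain w z where w: "w \<notin> W" "transpose (cmat A) *v w - z *s w \<in> W"
      using ex_quotient_eigenvector[OF W(1) \<open>W \<noteq> UNIV\<close>] by blast
    obtain x where "x \<noteq> 0" "transpose (cmat A) *v x = z *s x"
      using quotient_eigenvalue_imp_eigenvalue[OF W w] by blast
    then have "Re z < 0" using eigenvalue_transpose eig by blast
    then obtain b' where b': "lyapunov_form A b'" "dominates b' {a *s w + u | a u. u \<in> W}"
      using lyapunov_form_extend[OF b w(2)] by blast
    define W' where "W' = {a *s w + u | a u. u \<in> W}"
    have "W' = vec.span (insert w W)"
      unfolding W'_def vec.span_insert vec.span_eq_iff[THEN iffD2, OF W(1)] by (auto) (metis add_diff_cancel_left' diff_add_cancel add.commute)+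
    then have sub: "vec.subspace W'" by simp
    have inv: "transpose (cmat A) *v x \<in> W'" if "x \<in> W'" for x
    proof -
      from that obtain a u where x: "x = a *s w + u" "u \<in> W" unfolding W'_def by blast
      have "transpose (cmat A) *v x = (a * z) *s w +
          (a *s (transpose (cmat A) *v w - z *s w) + transpose (cmat A) *v u)"
        by (simp add: x(1) matrix_vector_right_distrib vector_scalar_commute vec.scale_right_diff_distrib)
      moreover have "a *s (transpose (cmat A) *v w - z *s w) + transpose (cmat A) *v u \<in> W"
        using W w(2) x(2) by (intro vec.subspace_add vec.subspace_scale) auto
      ultimately show ?thesis unfolding W'_def by blast
    qed
    have "W \<subset> W'"
    proof -
      have "u \<in> W'" if "u \<in> W" for u unfolding W'_def using that by (intro CollectI exI[of _ 0] exI[of _ u]) auto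
      moreover have "w \<in> W'" unfolding W'_def using vec.subspace_0[OF W(1)] by (intro CollectI exI[of _ 1] exI[of _ 0]) auto
      ultimately show ?thesis using w(1) by blast
    qed
    then have "vec.dim W < vec.dim W'"
      using W(1) sub by (intro vec.dim_psubset) (simp add: vec.span_eq_iff[THEN iffD2])
    then show ?thesis using sub inv b' unfolding good_def W'_def by blast
  qed
  have "good {0}"
  proof -
    have "lyapunov_form A (\<lambda>_ _. 0)"
      unfolding lyapunov_form_def bilinear_def by (auto intro!: exI[of _ 1] linearI)
    moreover have "dominates (\<lambda>_ _. 0) {0::complex^'n}" by (auto simp: dominates_def cpair_def)
    ultimately show ?thesis unfolding good_def by (auto simp: vec.subspace_def)
  qed
  moreover have "\<forall>W. good W \<longrightarrow> vec.dim W < CARD('n) + 1"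
    by (metis vec.dim_subset_UNIV vec_dim_card subset_UNIV vec.dim_subset Suc_eq_plus1 le_imp_less_Suc)
  ultimately obtain W where "good W" and max: "\<And>W'. good W' \<Longrightarrow> vec.dim W' \<le> vec.dim W"
    using ex_has_greatest_nat[of good "{0}" vec.dim] by (metis not_less)
  then have "W = UNIV" using step by (metis not_less)
  then obtain b where b: "lyapunov_form A b" "dominates b UNIV" using \<open>good W\<close> unfolding good_def by blast
  have "\<exists>K\<ge>0. \<forall>v. (v$j)\<^sup>2 \<le> K * b v v" for j
  proof -
    have "cpair (axis j 1) v = of_real (v$j)" for v
      by (simp add: cpair_def axis_def if_distrib[of "\<lambda>x. x * _"] cong: if_cong)
    then show ?thesis using b(2) unfolding dominates_def by (metis UNIV_I norm_of_real power2_abs)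
  qed
  then obtain K where K: "\<And>j. K j \<ge> 0" "\<And>j v. (v$j)\<^sup>2 \<le> K j * b v v" by metis
  have nn: "0 \<le> b v v" for v using b(1) by (simp add: lyapunov_form_def)
  have "(norm v)\<^sup>2 \<le> ((\<Sum>j\<in>UNIV. K j) + 1) * b v v" for v
  proof -
    have "(norm v)\<^sup>2 = (\<Sum>j\<in>UNIV. (v$j)\<^sup>2)" by (simp add: norm_vec_def L2_set_def sum_nonneg)
    also have "\<dots> \<le> (\<Sum>j\<in>UNIV. K j * b v v)" by (intro sum_mono K)
    also have "\<dots> \<le> ((\<Sum>j\<in>UNIV. K j) + 1) * b v v" using nn[of v] by (simp add: sum_distrib_right distrib_right)
    finally show ?thesis .
  qed
  moreover have "(\<Sum>j\<in>UNIV. K j) + 1 > 0" using K(1) by (simp add: add_nonneg_pos sum_nonneg)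
  ultimately show thesis using that b(1) by blast
qed

section \<open>The zero eigenvalue of the Jacobian\<close>

lemma poly_det:
  fixes A :: "'a::comm_ring_1 poly^'n^'n"
  shows "poly (det A) z = det (\<chi> i j. poly (A$i$j) z)"
  unfolding det_def by (simp add: poly_sum poly_prod)

lemma poly_char_poly: "poly (char_poly J) z = det (mat z - cmat J)"
  unfolding char_poly_def poly_det
  by (rule arg_cong[of _ _ det]) (simp add: vec_eq_iff mat_def cmat_def)

definition cvec :: "real^'n \<Rightarrow> complex^'n" where
  "cvec m = (\<chi> i. of_real (m$i))"

lemma cvec_0 [simp]: "cvec 0 = 0"
  by (simp add: cvec_def vec_eq_iff)

lemma cmat_mult_cvec: "cmat J *v cvec m = cvec (J *v m)"
  by (simp add: cmat_def cvec_def matrix_vector_mult_def vec_eq_iff)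

text \<open>Adding multiples of the other columns, column \<open>k\<close> of \<open>z - J\<close> becomes \<open>z m / m $ k\<close>; the factor \<open>z\<close> is
  the only one that simplicity allows, so what remains is invertible at \<open>z = 0\<close>.\<close>

lemma simple_zero_eigenvalue_kernel:
  fixes J :: "real^'n^'n"
  assumes ord: "order 0 (char_poly J) = 1" "char_poly J \<noteq> 0"
    and m: "J *v m = 0" "m \<noteq> 0" and x: "cmat J *v x = 0"
  shows "\<exists>c. x = c *s cvec m"
proof -
  obtain k where k: "m$k \<noteq> 0" using m(2) by (auto simp: vec_eq_iff)
  \<comment> \<open>Transposed, so that column operations on \<open>z - J\<close> become row
    operations; row \<open>k\<close> is the replaced column with the factor \<open>z\<close> taken
    out.\<close>
  define C where "C = (\<chi> i j. if i = k then [:cvec m $ j / cvec m $ k:]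
      else (if i = j then [:0, 1:] else 0) - [:complex_of_real (J$j$i):])"
  define B where "B z = transpose (mat z - cmat J)" for z
  define R where "R z = (\<chi> i. if i = k then (1 / cvec m $ k) *s cvec m else row i (B z))" for z
  have mk: "cvec m $ k \<noteq> 0" using k by (simp add: cvec_def)
  have R: "poly (det C) z = det (R z)" for z
    unfolding poly_det R_def C_def B_def
    by (rule arg_cong[of _ _ det]) (auto simp: vec_eq_iff row_def transpose_def mat_def cmat_def)
  have comb: "(\<Sum>i\<in>UNIV. u$i *s row i (B z)) = z *s u - cmat J *v u" for u z
  proof -
    have "(\<Sum>i\<in>UNIV. u$i *s row i (B z)) = (mat z - cmat J) *v u"
      by (simp add: B_def row_def transpose_def matrix_vector_mult_def vec_eq_iff mult.commute)
    also have "\<dots> = z *s u - cmat J *v u"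
      by (simp add: matrix_vector_mult_diff_rdistrib) (simp add: matrix_vector_mult_def mat_def vec_eq_iff
        if_distrib[of "\<lambda>y. y * a" for a] cong: if_cong)
    finally show ?thesis .
  qed
  have "poly (char_poly J) z = poly ([:0, 1:] * det C) z" for z
  proof -
    define y where "y = (\<Sum>i\<in>UNIV - {k}. (cvec m $ i / cvec m $ k) *s row i (B z))"
    have y: "y \<in> vec.span {row j (B z) |j. j \<noteq> k}"
      unfolding y_def by (intro vec.span_sum vec.span_scale vec.span_base) auto
    have rowk: "row k (B z) + y = z *s ((1 / cvec m $ k) *s cvec m)"
    proof -
      have "row k (B z) + y = (\<Sum>i\<in>UNIV. (cvec m $ i / cvec m $ k) *s row i (B z))"
        unfolding y_def using mk by (subst sum.remove[of UNIV k]) auto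
      also have "\<dots> = (1 / cvec m $ k) *s (\<Sum>i\<in>UNIV. cvec m $ i *s row i (B z))"
        by (simp add: vec.scale_sum_right)
      also have "\<dots> = (1 / cvec m $ k) *s (z *s cvec m)"
        unfolding comb cmat_mult_cvec m(1) by simp
      finally show ?thesis by (simp add: mult.commute)
    qed
    have "det (\<chi> l. if l = k then row k (B z) + y else row l (B z)) = det (B z)"
      by (rule det_row_span[OF y])
    then have "det (B z) = det (\<chi> l. if l = k then z *s ((1 / cvec m $ k) *s cvec m) else row l (B z))"
      unfolding rowk by (rule sym)
    also have "\<dots> = z * det (R z)" unfolding R_def by (rule det_row_mul)
    finally show ?thesis by (simp add: poly_char_poly R B_def)
  qed
  then have fac: "char_poly J = [:0, 1:] * det C" by (simp add: poly_eq_poly_eq_iff[symmetric] fun_eq_iff)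
  have "poly (det C) 0 \<noteq> 0"
  proof
    assume "poly (det C) 0 = 0"
    then have "[:- 0, 1:] dvd det C" by (simp add: poly_eq_0_iff_dvd)
    then have "[:- 0, 1:]^2 dvd char_poly J" unfolding fac power2_eq_square by (intro mult_dvd_mono) auto
    then show False using ord order_divides[of 0 2 "char_poly J"] by simp
  qed
  then have "invertible (transpose (R 0))" by (simp add: R invertible_det_nz)
  then have inj: "transpose (R 0) *v u = 0 \<Longrightarrow> u = 0" for u
    unfolding invertible_left_inverse matrix_left_invertible_ker by blast
  \<comment> \<open>A multiple of \<open>m\<close> is subtracted to make coordinate \<open>k\<close>
    vanish. Row \<open>k\<close> is then not seen, so the rows of \<open>R 0\<close> combine with
    weights \<open>u\<close> as those of \<open>B 0\<close> do, that is to
    \<open>- (J u) = 0\<close>, and invertibility gives \<open>u = 0\<close>.\<close>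
  define u where "u = x - (x$k / cvec m $ k) *s cvec m"
  have uk: "u$k = 0" using mk by (simp add: u_def)
  have "transpose (R 0) *v u = (\<Sum>i\<in>UNIV. u$i *s row i (R 0))"
    by (simp add: row_def transpose_def matrix_vector_mult_def vec_eq_iff mult.commute)
  also have "\<dots> = (\<Sum>i\<in>UNIV. u$i *s row i (B 0))"
  proof (rule sum.cong)
    fix i show "u$i *s row i (R 0) = u$i *s row i (B 0)"
      using uk by (cases "i = k") (auto simp: R_def row_def vec_eq_iff)
  qed simp
  also have "\<dots> = 0"
    unfolding comb u_def matrix_vector_mult_diff_distrib vector_scalar_commute x cmat_mult_cvec m(1)
    by simp
  finally have "u = 0" by (rule inj)
  then show ?thesis unfolding u_def by auto
qed

text \<open>On vectors of sum zero this matrix agrees with \<open>J\<close>, while the zero eigenvalue of \<open>J\<close>, whose eigenvector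
  \<open>m\<close> is transversal to that hyperplane, is moved to \<open>-1\<close>.\<close>

definition deflate :: "real^'n^'n \<Rightarrow> real^'n \<Rightarrow> real^'n^'n" where
  "deflate J m = (\<chi> i j. J$i$j - m$i)"

lemma deflate_mult: "deflate J m *v v = J *v v - (\<Sum>j\<in>UNIV. v$j) *s m"
  by (simp add: deflate_def matrix_vector_mult_def vec_eq_iff left_diff_distrib sum_subtractf
      sum_distrib_left sum_distrib_right) (simp add: mult.commute)

text \<open>Adding up the coordinates of the eigenvector equation, where \<open>J\<close>
  contributes nothing, gives \<open>(z + 1) * s = 0\<close> with \<open>s\<close> the sum of
  \<open>x\<close>. So \<open>z = -1\<close>, or \<open>s = 0\<close> and \<open>x\<close> is an
  eigenvector of \<open>J\<close>. In the latter case \<open>z = 0\<close> is excluded: simplicity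
  would make \<open>x\<close> a multiple of \<open>m\<close>, and sum zero then gives
  \<open>x = 0\<close>.\<close>

lemma deflate_hurwitz:
  fixes J :: "real^'n^'n"
  assumes ord: "order 0 (char_poly J) = 1"
    and roots: "\<And>z. poly (char_poly J) z = 0 \<Longrightarrow> z = 0 \<or> Re z < 0"
    and m: "J *v m = 0" "(\<Sum>i\<in>UNIV. m$i) = 1"
    and cols: "\<And>j. (\<Sum>i\<in>UNIV. J$i$j) = 0"
    and x: "x \<noteq> 0" "cmat (deflate J m) *v x = z *s x"
  shows "Re z < 0"
proof -
  define s where "s = (\<Sum>i\<in>UNIV. x$i)"
  have "cmat (deflate J m) *v x = cmat J *v x - s *s cvec m"
    by (simp add: s_def cmat_def cvec_def deflate_def matrix_vector_mult_def vec_eq_iff left_diff_distrib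
        sum_subtractf sum_distrib_left sum_distrib_right) (simp add: mult.commute)
  then have Jx: "cmat J *v x = z *s x + s *s cvec m" using x(2) by (simp add: algebra_simps)
  have "(\<Sum>i\<in>UNIV. (cmat J *v x)$i) = (\<Sum>j\<in>UNIV. \<Sum>i\<in>UNIV. of_real (J$i$j) * x$j)"
    by (simp add: matrix_vector_mult_def cmat_def) (rule sum.swap)
  also have "\<dots> = (\<Sum>j\<in>UNIV. of_real (\<Sum>i\<in>UNIV. J$i$j) * x$j)" by (simp add: sum_distrib_right)
  also have "\<dots> = 0" by (simp add: cols del: of_real_sum)
  finally have "(\<Sum>i\<in>UNIV. (z *s x + s *s cvec m)$i) = 0" unfolding Jx .
  moreover have "(\<Sum>i\<in>UNIV. cvec m $ i) = 1"
    using m(2) by (simp add: cvec_def flip: of_real_sum)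
  ultimately have "z * s + s = 0" by (simp add: sum.distrib flip: sum_distrib_left s_def)
  then have "(z + 1) * s = 0" by (simp add: distrib_right)
  then consider "z = -1" | "s = 0" by (auto simp: eq_neg_iff_add_eq_0)
  then show ?thesis
  proof cases
    case 2
    then have Jz: "cmat J *v x = z *s x" using Jx by simp
    have "z \<noteq> 0"
    proof
      assume "z = 0"
      \<comment> \<open>The zero polynomial would have the root 1, which \<open>roots\<close> rules
        out.\<close>
      have "char_poly J \<noteq> 0" using roots[of 1] by auto
      moreover have "m \<noteq> 0" using m(2) by auto
      ultimately obtain c where c: "x = c *s cvec m"
        using simple_zero_eigenvalue_kernel[OF ord _ m(1)] Jz \<open>z = 0\<close> by auto
      then have "s = c" using \<open>(\<Sum>i\<in>UNIV. cvec m $ i) = 1\<close> by (simp add: s_def flip: sum_distrib_left)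
      then show False using 2 c x(1) by simp
    qed
    moreover have "poly (char_poly J) z = 0"
    proof -
      have "\<not> invertible (mat z - cmat J)"
        unfolding invertible_left_inverse matrix_left_invertible_ker
      proof
        assume "\<forall>y. (mat z - cmat J) *v y = 0 \<longrightarrow> y = 0"
        moreover have "(mat z - cmat J) *v x = - ((cmat J - mat z) *v x)"
          by (simp only: matrix_vector_mult_diff_rdistrib minus_diff_eq)
        ultimately show False using x(1) Jz by (simp add: matrix_diff_mat_mult)
      qed
      then show ?thesis by (simp add: poly_char_poly invertible_det_nz)
    qed
    ultimately show ?thesis using roots by blast
  qed simp
qed

section \<open>Exponential stability\<close>

lemma AE_lborel_negligible:
  assumes "AE t in lborel. P t"
  shows "negligible {t. \<not> P t}"
proof -
  obtain N where "N \<in> null_sets lborel" "{t. \<not> P t} \<subseteq> N"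
    using assms by (auto simp: eventually_ae_filter)
  then show ?thesis
    by (meson negligible_iff_null_sets negligible_subset null_sets_completionI)
qed

lemma abs_exp_diff_le:
  fixes s t :: real
  assumes "s \<le> T" "t \<le> T"
  shows "\<bar>exp t - exp s\<bar> \<le> exp T * \<bar>t - s\<bar>"
proof -
  have *: "exp v - exp u \<le> exp T * (v - u)" if "u \<le> v" "v \<le> T" for u v :: real
  proof -
    have "exp v - exp u = exp v * (1 - exp (u - v))" by (simp add: right_diff_distrib flip: exp_add)
    also have "\<dots> \<le> exp v * (v - u)"
      by (intro mult_left_mono) (use exp_ge_add_one_self[of "u - v"] in linarith, simp)
    also have "\<dots> \<le> exp T * (v - u)" using that by (intro mult_right_mono) auto
    finally show ?thesis .
  qed
  show ?thesis using *[of s t] *[of t s] assms by (cases "s \<le> t") auto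
qed

text \<open>A continuation argument: the differential inequality is known only inside the ball of
  radius \<open>\<rho>\<close>. Up to a first exit time \<open>\<tau>\<close> the weighted form
  \<open>y\<close> does not increase, so \<open>K * b (x \<tau>) (x \<tau>) \<le> K * b (x 0) (x 0)
  < \<rho>\<^sup>2\<close>; since the left side bounds the squared norm, there is no exit.\<close>

lemma lyapunov_exponential_decay:
  fixes b :: "real^'n \<Rightarrow> real^'n \<Rightarrow> real" and x :: "real \<Rightarrow> real^'n"
  assumes bil: "bilinear b" and sym: "\<And>u v. b u v = b v u"
    and "K > 0" and K: "\<And>v. (norm v)\<^sup>2 \<le> K * b v v"
    and "c > 0" and dec: "\<And>v. v \<in> S \<Longrightarrow> norm v < \<rho> \<Longrightarrow> b v (g v) \<le> - c * b v v"
    and ac: "\<And>T. T \<ge> 0 \<Longrightarrow> abs_continuous_on_interval 0 T x"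
    and S: "\<And>t. t \<ge> 0 \<Longrightarrow> x t \<in> S"
    and der: "AE t in lborel. 0 \<le> t \<longrightarrow> norm (x t) < \<rho> \<longrightarrow> (x has_vector_derivative g (x t)) (at t)"
    and "\<rho> > 0" and init: "K * b (x 0) (x 0) < \<rho>\<^sup>2" and "t \<ge> 0"
  shows "(norm (x t))\<^sup>2 \<le> K * b (x 0) (x 0) * exp (- 2 * c * t)"
proof -
  have bb: "bounded_bilinear b" using bil by (simp add: bilinear_conv_bounded_bilinear)
  obtain L where "L > 0" and L: "\<And>u v. \<bar>b u v\<bar> \<le> norm u * norm v * L"
    using bounded_bilinear.pos_bounded[OF bb] by auto
  define y where "y t = exp (2 * c * t) * b (x t) (x t)" for t
  have ac_y: "abs_continuous_on_interval 0 T y" if "T \<ge> 0" for T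
  proof -
    have "bounded (x ` {0..T})"
      using abs_continuous_imp_continuous_on[OF ac[OF that]]
      by (intro compact_imp_bounded compact_continuous_image) auto
    then obtain M where "M > 0" and M: "\<And>s. s \<in> {0..T} \<Longrightarrow> norm (x s) \<le> M"
      unfolding bounded_pos by auto
    define E where "E = exp (2 * c * T)"
    have "E > 0" by (simp add: E_def)
    \<comment> \<open>Product rule for increments: the first summand bounds the exponential times
      the change of the form, the second the form times the change of the exponential.\<close>
    define C where "C = E * (2 * M * L) + (M * M * L) * (E * (2 * c))"
    show ?thesis
    proof (rule abs_continuous_dominated[OF ac[OF that]])
      show "C > 0" using \<open>M > 0\<close> \<open>L > 0\<close> \<open>E > 0\<close> \<open>c > 0\<close> by (simp add: C_def add_pos_pos)
      fix s t assume st: "s \<in> {0..T}" "t \<in> {0..T}"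
      have "b (x t) (x t) - b (x s) (x s) = b (x t - x s) (x t + x s)"
        by (simp add: bilinear_lsub[OF bil] bilinear_radd[OF bil] sym[of "x s" "x t"])
      moreover have "\<bar>b (x t - x s) (x t + x s)\<bar> \<le> norm (x t - x s) * (2 * M) * L"
      proof (rule order_trans[OF L])
        have "norm (x t + x s) \<le> 2 * M" using M[OF st(1)] M[OF st(2)] norm_triangle_ineq[of "x t" "x s"] by simp
        then show "norm (x t - x s) * norm (x t + x s) * L \<le> norm (x t - x s) * (2 * M) * L"
          using \<open>L > 0\<close> by (intro mult_right_mono mult_left_mono) auto
      qed
      ultimately have 1: "\<bar>b (x t) (x t) - b (x s) (x s)\<bar> \<le> norm (x t - x s) * (2 * M) * L" by simp
      have 2: "\<bar>b (x s) (x s)\<bar> \<le> M * M * L"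
        using M[OF st(1)] \<open>L > 0\<close> \<open>M > 0\<close> by (intro order_trans[OF L] mult_right_mono mult_mono) auto
      have 3: "\<bar>exp (2 * c * t) - exp (2 * c * s)\<bar> \<le> E * (2 * c * \<bar>t - s\<bar>)"
        using abs_exp_diff_le[of "2 * c * s" "2 * c * T" "2 * c * t"] st \<open>c > 0\<close>
        by (simp add: E_def abs_mult flip: right_diff_distrib)
      have 4: "exp (2 * c * t) \<le> E" using st \<open>c > 0\<close> by (simp add: E_def)
      have "y t - y s = exp (2 * c * t) * (b (x t) (x t) - b (x s) (x s))
          + b (x s) (x s) * (exp (2 * c * t) - exp (2 * c * s))"
        by (simp add: y_def algebra_simps)
      also have "\<bar>\<dots>\<bar> \<le> exp (2 * c * t) * \<bar>b (x t) (x t) - b (x s) (x s)\<bar>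
          + \<bar>b (x s) (x s)\<bar> * \<bar>exp (2 * c * t) - exp (2 * c * s)\<bar>"
        by (rule order_trans[OF abs_triangle_ineq]) (simp add: abs_mult)
      also have "\<dots> \<le> E * (norm (x t - x s) * (2 * M) * L) + (M * M * L) * (E * (2 * c * \<bar>t - s\<bar>))"
        using 1 2 3 4 \<open>E > 0\<close> \<open>L > 0\<close> \<open>M > 0\<close> by (intro add_mono mult_mono) auto
      also have "\<dots> = E * (2 * M * L) * norm (x t - x s) + (M * M * L) * (E * (2 * c)) * \<bar>t - s\<bar>"
        by (simp add: mult_ac)
      also have "\<dots> \<le> C * norm (x t - x s) + C * \<bar>t - s\<bar>"
        using \<open>E > 0\<close> \<open>L > 0\<close> \<open>M > 0\<close> \<open>c > 0\<close> by (intro add_mono mult_right_mono) (auto simp: C_def)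
      finally show "norm (y t - y s) \<le> C * (\<bar>t - s\<bar> + norm (x t - x s))"
        by (simp add: algebra_simps)
    qed
  qed
  define N where "N = {t. \<not> (0 \<le> t \<longrightarrow> norm (x t) < \<rho> \<longrightarrow> (x has_vector_derivative g (x t)) (at t))}"
  have "negligible N" unfolding N_def by (rule AE_lborel_negligible[OF der])
  have mono: "y T \<le> y 0" if T: "T \<ge> 0" "\<And>s. 0 \<le> s \<Longrightarrow> s < T \<Longrightarrow> norm (x s) < \<rho>" for T
  proof (rule abs_continuous_nonincreasing[OF T(1) ac_y[OF T(1)]])
    \<comment> \<open>The end point joins the exceptional set because at a first exit time the norm
      is no longer below \<open>\<rho>\<close>.\<close>
    show "negligible (insert T N)" using \<open>negligible N\<close> by simp
    fix t assume t: "t \<in> {0..T} - insert T N"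
    then have near: "norm (x t) < \<rho>" using T(2) by auto
    then have d: "(x has_vector_derivative g (x t)) (at t)" using t by (simp add: N_def)
    have "((\<lambda>t. b (x t) (x t)) has_vector_derivative (b (x t) (g (x t)) + b (g (x t)) (x t))) (at t)"
      by (rule bounded_bilinear.has_vector_derivative[OF bb d d])
    then have db: "((\<lambda>t. b (x t) (x t)) has_real_derivative (2 * b (x t) (g (x t)))) (at t)"
      by (simp add: has_real_derivative_iff_has_vector_derivative sym[of "g (x t)"])
    have "(y has_real_derivative (exp (2*c*t) * (2*c) * b (x t) (x t) + exp (2*c*t) * (2 * b (x t) (g (x t))))) (at t)"
      unfolding y_def by (auto intro!: derivative_eq_intros db)
    moreover have "exp (2*c*t) * (2*c) * b (x t) (x t) + exp (2*c*t) * (2 * b (x t) (g (x t)))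
        = 2 * exp (2*c*t) * (c * b (x t) (x t) + b (x t) (g (x t)))" by (simp add: algebra_simps)
    moreover have "\<dots> \<le> 0"
      using dec[OF S near] t by (intro mult_nonneg_nonpos) auto
    ultimately show "\<exists>D\<le>0. (y has_real_derivative D) (at t)" by (intro exI conjI) auto
  qed
  have inside: "norm (x t) < \<rho>" if "t \<ge> 0" for t
  proof (rule ccontr)
    assume "\<not> norm (x t) < \<rho>"
    define Z where "Z = {s \<in> {0..t}. \<rho> \<le> norm (x s)}"
    have "continuous_on {0..t} (\<lambda>s. norm (x s))"
      using abs_continuous_imp_continuous_on[OF ac[OF that]] by (intro continuous_on_norm)
    then have "closed Z" unfolding Z_def
      by (intro continuous_on_closed_Collect_le continuous_on_const) auto
    then have "compact ({0..t} \<inter> Z)" by (intro compact_Int_closed) auto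
    moreover have "{0..t} \<inter> Z = Z" by (auto simp: Z_def)
    moreover have "t \<in> Z" using that \<open>\<not> norm (x t) < \<rho>\<close> by (simp add: Z_def)
    ultimately obtain \<tau> where \<tau>: "\<tau> \<in> Z" "\<And>s. s \<in> Z \<Longrightarrow> \<tau> \<le> s"
      using compact_attains_inf[of Z] by auto
    have "norm (x s) < \<rho>" if "0 \<le> s" "s < \<tau>" for s
      using \<tau>(2)[of s] that \<tau>(1) by (force simp: Z_def)
    then have "y \<tau> \<le> y 0" using \<tau>(1) by (intro mono) (auto simp: Z_def)
    moreover have "b (x \<tau>) (x \<tau>) \<le> y \<tau>"
    proof -
      have "0 \<le> b (x \<tau>) (x \<tau>)"
        using order_trans[OF zero_le_power2 K[of "x \<tau>"]] \<open>K > 0\<close> by (simp add: zero_le_mult_iff)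
      moreover have "1 \<le> exp (2 * c * \<tau>)" using \<tau>(1) \<open>c > 0\<close> by (simp add: Z_def)
      ultimately show ?thesis unfolding y_def using mult_right_mono[of 1 "exp (2 * c * \<tau>)"] by simp
    qed
    ultimately have "K * b (x \<tau>) (x \<tau>) \<le> K * b (x 0) (x 0)" using \<open>K > 0\<close> by (simp add: y_def)
    moreover have "\<rho>\<^sup>2 \<le> (norm (x \<tau>))\<^sup>2" using \<tau>(1) \<open>\<rho> > 0\<close> by (intro power_mono) (auto simp: Z_def)
    ultimately show False using K[of "x \<tau>"] init by linarith
  qed
  have "y t \<le> y 0" using inside \<open>t \<ge> 0\<close> by (intro mono) auto
  then have "b (x t) (x t) \<le> b (x 0) (x 0) * exp (- 2 * c * t)"
    by (simp add: y_def exp_minus field_simps)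
  then have "K * b (x t) (x t) \<le> K * (b (x 0) (x 0) * exp (- 2 * c * t))" using \<open>K > 0\<close> by simp
  then show ?thesis using K[of "x t"] by (simp add: mult.assoc)
qed

section \<open>Tangency to the simplex and linearisation at the equilibrium\<close>

lemma flowvec_sum_zero:
  assumes "is_generator G"
  shows "(\<Sum>j\<in>UNIV. flowvec G v $ j) = 0"
proof -
  have "(\<Sum>j\<in>UNIV. flowvec G v $ j) = (\<Sum>i\<in>UNIV. v$i * (\<Sum>j\<in>UNIV. G i j))"
    unfolding flowvec_def by (simp add: sum_distrib_left) (rule sum.swap)
  then show ?thesis using assms by (simp add: is_generator_def)
qed

lemma prob_simplex_segment:
  assumes "p \<in> prob_simplex" "t \<in> {0..1}"
  shows "p + t *\<^sub>R (axis k 1 - p) \<in> prob_simplex"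
proof -
  have p: "0 \<le> p$i" "(\<Sum>i\<in>UNIV. p$i) = 1" for i using assms(1) by (auto simp: prob_simplex_def)
  have "(p + t *\<^sub>R (axis k 1 - p))$i = (1 - t) * p$i + t * axis k 1 $ i" for i
    by (simp add: algebra_simps)
  moreover have "0 \<le> (1 - t) * p$i + t * axis k 1 $ i" for i
    using assms(2) p(1) by (auto simp: axis_def)
  moreover have "(\<Sum>i\<in>UNIV. (1 - t) * p$i + t * axis k 1 $ i) = 1"
    using p(2) by (simp add: sum.distrib axis_def flip: sum_distrib_left)
  ultimately show ?thesis by (simp add: prob_simplex_def)
qed

text \<open>The coordinates of \<open>f\<close> are known to sum to zero only on the simplex, and
  \<open>p\<close> may be a boundary point. The segment from \<open>p\<close> to the vertex
  \<open>axis k 1\<close> stays inside; as \<open>J *v p = 0\<close>, the one-sided derivative of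
  the coordinate sum along it is the sum of column \<open>k\<close>.\<close>

lemma jacobian_column_sum_zero:
  assumes jac: "(f has_derivative (*v) J) (at p)" and p: "p \<in> prob_simplex" and "J *v p = 0"
    and zero: "\<And>m. m \<in> prob_simplex \<Longrightarrow> (\<Sum>i\<in>UNIV. f m $ i) = 0"
  shows "(\<Sum>i\<in>UNIV. J$i$k) = 0"
proof -
  define \<gamma> where "\<gamma> t = p + t *\<^sub>R (axis k 1 - p)" for t
  have "(\<gamma> has_derivative (\<lambda>t. t *\<^sub>R (axis k 1 - p))) (at 0 within {0..1})"
    unfolding \<gamma>_def by (auto intro!: derivative_eq_intros)
  moreover have "(f has_derivative (*v) J) (at (\<gamma> 0))" using jac by (simp add: \<gamma>_def)
  ultimately have "((\<lambda>t. f (\<gamma> t)) has_derivative (\<lambda>t. J *v (t *\<^sub>R (axis k 1 - p)))) (at 0 within {0..1})"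
    by (rule has_derivative_compose)
  moreover have "bounded_linear (\<lambda>v::real^'n. \<Sum>i\<in>UNIV. v$i)"
    by (intro bounded_linear_sum bounded_linear_vec_nth)
  ultimately have "((\<lambda>t. \<Sum>i\<in>UNIV. f (\<gamma> t) $ i) has_derivative
      (\<lambda>t. \<Sum>i\<in>UNIV. (J *v (t *\<^sub>R (axis k 1 - p))) $ i)) (at 0 within {0..1})"
    by (rule bounded_linear.has_derivative[rotated])
  moreover have "(J *v (t *\<^sub>R (axis k 1 - p))) $ i = t * J$i$k" for t i
    using \<open>J *v p = 0\<close>
    by (simp add: matrix_vector_mult_scaleR matrix_vector_mult_diff_distrib matrix_vector_mult_basis column_def)
  ultimately have "((\<lambda>t. \<Sum>i\<in>UNIV. f (\<gamma> t) $ i) has_vector_derivative (\<Sum>i\<in>UNIV. J$i$k)) (at 0 within {0..1})"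
    by (simp add: has_vector_derivative_def sum_distrib_left)
  moreover have "((\<lambda>t. \<Sum>i\<in>UNIV. f (\<gamma> t) $ i) has_vector_derivative 0) (at 0 within {0..1})"
    using zero prob_simplex_segment[OF p]
    by (intro has_vector_derivative_transform[OF _ _ has_vector_derivative_const[of 0]]) (auto simp: \<gamma>_def)
  ultimately show ?thesis
    using vector_derivative_unique_within_closed_interval[of 0 1 "0::real"] by simp
qed

lemma lyapunov_form_perturbation:
  assumes b: "lyapunov_form A b" and "K > 0" and K: "\<And>v. (norm v)\<^sup>2 \<le> K * b v v"
    and g: "(g has_derivative (*v) J) (at 0)" "g 0 = 0"
    and A: "\<And>v. v \<in> S \<Longrightarrow> J *v v = A *v v"
  obtains c \<delta> where "c > 0" and "\<delta> > 0"
    and "\<And>v. v \<in> S \<Longrightarrow> norm v < \<delta> \<Longrightarrow> b v (g v) \<le> - c * b v v"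
proof -
  from b obtain c where bil: "bilinear b" and nn: "\<And>v. 0 \<le> b v v"
      and "c > 0" and c: "\<And>v. b v (A *v v) \<le> - c * b v v"
    unfolding lyapunov_form_def by blast
  obtain L where "L > 0" and L: "\<And>u v. \<bar>b u v\<bar> \<le> norm u * norm v * L"
    using bounded_bilinear.pos_bounded[of b] bil by (auto simp: bilinear_conv_bounded_bilinear)
  \<comment> \<open>With this tolerance the linearisation error changes \<open>b v (g v)\<close> by
    at most \<open>e * L * K * b v v = c / 2 * b v v\<close>, leaving half of the decay
    rate.\<close>
  define e where "e = c / (2 * K * L)"
  have "e > 0" using \<open>c > 0\<close> \<open>K > 0\<close> \<open>L > 0\<close> by (simp add: e_def)
  then obtain \<delta> where "\<delta> > 0" and \<delta>: "\<And>v. norm v < \<delta> \<Longrightarrow> norm (g v - J *v v) \<le> e * norm v"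
    using g unfolding has_derivative_at_alt by auto
  have "b v (g v) \<le> - (c / 2) * b v v" if v: "v \<in> S" "norm v < \<delta>" for v
  proof -
    have "b v (g v) = b v (A *v v) + b v (g v - J *v v)"
      using A[OF v(1)] by (simp add: bilinear_rsub[OF bil])
    also have "b v (g v - J *v v) \<le> norm v * norm (g v - J *v v) * L"
      using L[of v "g v - J *v v"] by linarith
    also have "\<dots> \<le> norm v * (e * norm v) * L"
      using \<delta>[OF v(2)] \<open>L > 0\<close> by (intro mult_right_mono mult_left_mono) auto
    also have "\<dots> = e * L * (norm v)\<^sup>2" by (simp add: power2_eq_square)
    also have "\<dots> \<le> e * L * (K * b v v)" using K \<open>e > 0\<close> \<open>L > 0\<close> by (intro mult_left_mono) auto
    also have "\<dots> = c / 2 * b v v" using \<open>K > 0\<close> \<open>L > 0\<close> by (simp add: e_def)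
    also note c[of v]
    finally show ?thesis by simp
  qed
  then show thesis using that[of "c / 2" \<delta>] \<open>c > 0\<close> \<open>\<delta> > 0\<close> by simp
qed

theorem theorem4p4:
  fixes Q :: "'s::finite \<Rightarrow> 's \<Rightarrow> 'a::finite \<Rightarrow> real^'s \<Rightarrow> real"
    and r :: "'s \<Rightarrow> 'a \<Rightarrow> real^'s \<Rightarrow> real"
    and \<beta> :: real
    and mbar :: "real^'s"
    and d :: "'s \<Rightarrow> 'a"
    and U :: "(real^'s) set"
    and J :: "real^'s^'s"
  assumes std: "standing_assms Q r \<beta>"
    and eq: "stationary_mfe Q r \<beta> mbar (det_strat d)"
    and uniq: "Dset Q r \<beta> mbar = {d}"
    and O_open: "open U"
    and O_sup: "prob_simplex \<subseteq> U"
    and Qd_lip: "\<forall>i j. \<exists>L. L-lipschitz_on U (Q i j (d i))"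
    and Qd_gen: "\<forall>m\<in>prob_simplex. is_generator (\<lambda>i j. Q i j (d i) m)"
    and fd_C1: "\<exists>f'. (\<forall>x\<in>U. ((\<lambda>m. flowvec (\<lambda>i j. Q i j (d i) m) m) has_derivative blinfun_apply (f' x)) (at x))
                     \<and> continuous_on U f'"
    and jac: "((\<lambda>m. flowvec (\<lambda>i j. Q i j (d i) m) m) has_derivative (\<lambda>v. J *v v)) (at mbar)"
    and eig0: "J *v mbar = 0"
    and simple0: "order 0 (char_poly J) = 1"
    and eig_neg: "\<forall>z. poly (char_poly J) z = 0 \<longrightarrow> z = 0 \<or> Re z < 0"
  shows "\<exists>\<delta>>0. \<forall>m0\<in>prob_simplex. norm (m0 - mbar) < \<delta> \<longrightarrow>
           (\<forall>m. myopic_trajectory Q r \<beta> m0 m \<longrightarrow>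
              (\<exists>C1>0. \<exists>C2>0. \<forall>t\<ge>0. norm (m t - mbar) \<le> C1 * exp (- C2 * t)))"
proof -
  define f where "f m = flowvec (\<lambda>i j. Q i j (d i) m) m" for m
  have mbar: "mbar \<in> prob_simplex" and sum_mbar: "(\<Sum>i\<in>UNIV. mbar$i) = 1"
    using eq by (auto simp: stationary_mfe_def prob_simplex_def)
  have "Qpi Q (det_strat d) mbar = (\<lambda>i j. Q i j (d i) mbar)"
    by (simp add: Qpi_def det_strat_def fun_eq_iff if_distrib[of "(*) _"] cong: if_cong)
  then have f0: "f mbar = 0" using eq by (simp add: stationary_mfe_def f_def)
  have jac': "(f has_derivative (*v) J) (at mbar)" using jac by (simp add: f_def[abs_def])
  define A where "A = deflate J mbar"
  have cols: "(\<Sum>i\<in>UNIV. J$i$k) = 0" for k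
    using Qd_gen by (intro jacobian_column_sum_zero[OF jac' mbar eig0]) (auto simp: f_def flowvec_sum_zero)
  have hurwitz: "Re z < 0" if "x \<noteq> 0" "cmat A *v x = z *s x" for z x
    using deflate_hurwitz[OF simple0 _ eig0 sum_mbar cols that(1)] that(2) eig_neg unfolding A_def by blast
  obtain b K where b: "lyapunov_form A b" and "K > 0" and K: "\<And>v. (norm v)\<^sup>2 \<le> K * b v v"
    using hurwitz_lyapunov_form[of A] hurwitz by blast
  define S :: "(real^'s) set" where "S = {v. (\<Sum>i\<in>UNIV. v$i) = 0}"
  define g where "g v = f (mbar + v)" for v
  have "((\<lambda>v. mbar + v) has_derivative (\<lambda>v. v)) (at 0)"
    by (auto intro!: derivative_eq_intros)
  then have "(g has_derivative (*v) J) (at 0)"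
    unfolding g_def by (rule has_derivative_compose) (use jac' in simp)
  moreover have "g 0 = 0" by (simp add: g_def f0)
  moreover have "J *v v = A *v v" if "v \<in> S" for v
    using that by (simp add: S_def A_def deflate_mult)
  ultimately obtain c \<delta>1 where "c > 0" and "\<delta>1 > 0"
    and dec: "\<And>v. v \<in> S \<Longrightarrow> norm v < \<delta>1 \<Longrightarrow> b v (g v) \<le> - c * b v v"
    using lyapunov_form_perturbation[OF b \<open>K > 0\<close> K] by blast
  \<comment> \<open>The neighbourhood given by the filter is punctured; at \<open>m = mbar\<close>
    the claim is \<open>uniq\<close>.\<close>
  obtain \<delta>2 where "\<delta>2 > 0" and \<delta>2: "\<And>m. m \<in> prob_simplex \<Longrightarrow> norm (m - mbar) < \<delta>2 \<Longrightarrow> Dset Q r \<beta> m = {d}"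
    using eventually_Dset_eq[OF std mbar uniq] uniq unfolding eventually_at dist_norm by metis
  define \<rho> where "\<rho> = min \<delta>1 \<delta>2"
  have "\<rho> > 0" using \<open>\<delta>1 > 0\<close> \<open>\<delta>2 > 0\<close> by (simp add: \<rho>_def)
  have bil: "bilinear b" and sym: "\<And>u v. b u v = b v u" and nn: "\<And>v. 0 \<le> b v v"
    using b unfolding lyapunov_form_def by blast+
  obtain L where "L > 0" and L: "\<And>u v. \<bar>b u v\<bar> \<le> norm u * norm v * L"
    using bounded_bilinear.pos_bounded[of b] bil by (auto simp: bilinear_conv_bounded_bilinear)
  \<comment> \<open>Ensures \<open>K * b (x 0) (x 0) \<le> K * L * (norm (x 0))\<^sup>2 \<le> ((1 +
    K * L) * norm (x 0))\<^sup>2 < \<rho>\<^sup>2\<close>, so that the trajectory cannot leave the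
    ball of radius \<open>\<rho>\<close>.\<close>
  define \<delta> where "\<delta> = \<rho> / (1 + K * L)"
  have KL: "K * L > 0" using \<open>K > 0\<close> \<open>L > 0\<close> by simp
  then have "\<delta> > 0" using \<open>\<rho> > 0\<close> by (simp add: \<delta>_def)
  have "\<exists>C1>0. \<exists>C2>0. \<forall>t\<ge>0. norm (m t - mbar) \<le> C1 * exp (- C2 * t)"
    if m0: "norm (m0 - mbar) < \<delta>" and traj: "myopic_trajectory Q r \<beta> m0 m" for m0 m
  proof -
    define x where "x t = m t - mbar" for t
    have simplex: "m t \<in> prob_simplex" if "t \<ge> 0" for t
      using traj that by (simp add: myopic_trajectory_def)
    have x0: "norm (x 0) < \<delta>" using traj m0 by (simp add: x_def myopic_trajectory_def)
    define C where "C = K * b (x 0) (x 0)"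
    have "C \<ge> 0" using nn \<open>K > 0\<close> by (simp add: C_def)
    have init: "C < \<rho>\<^sup>2"
    proof -
      have "C \<le> K * (norm (x 0) * norm (x 0) * L)"
        unfolding C_def using L[of "x 0" "x 0"] \<open>K > 0\<close> by (intro mult_left_mono) auto
      also have "\<dots> = (K * L) * (norm (x 0))\<^sup>2" by (simp add: power2_eq_square)
      also have "\<dots> \<le> (1 + K * L)\<^sup>2 * (norm (x 0))\<^sup>2"
      proof (rule mult_right_mono)
        have "0 \<le> (K * L)\<^sup>2" by simp
        then show "K * L \<le> (1 + K * L)\<^sup>2" unfolding power2_sum using KL by simp
      qed simp
      also have "\<dots> = ((1 + K * L) * norm (x 0))\<^sup>2" by (simp add: power_mult_distrib)
      also have "\<dots> < \<rho>\<^sup>2"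
        using x0 KL by (intro power_strict_mono) (auto simp: \<delta>_def pos_less_divide_eq mult.commute)
      finally show ?thesis .
    qed
    have decay: "(norm (x t))\<^sup>2 \<le> C * exp (- 2 * c * t)" if "t \<ge> 0" for t
      unfolding C_def
    proof (rule lyapunov_exponential_decay[OF bil sym \<open>K > 0\<close> K \<open>c > 0\<close> _ _ _ _ \<open>\<rho> > 0\<close> _ that])
      show "b v (g v) \<le> - c * b v v" if "v \<in> S" "norm v < \<rho>" for v
        using dec that by (simp add: \<rho>_def)
      show "abs_continuous_on_interval 0 T x" if "T \<ge> 0" for T
      proof (rule abs_continuous_dominated[where K = 1])
        show "abs_continuous_on_interval 0 T m" using traj that by (simp add: myopic_trajectory_def)
      qed (auto simp: x_def)
      show "x t \<in> S" if "t \<ge> 0" for t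
        using simplex[OF that] sum_mbar by (simp add: x_def S_def prob_simplex_def sum_subtractf)
      have "AE t in lborel. 0 \<le> t \<longrightarrow> (\<exists>v. (m has_vector_derivative v) (at t) \<and> v \<in> Fmap Q r \<beta> (m t))"
        using traj by (simp add: myopic_trajectory_def)
      then show "AE t in lborel. 0 \<le> t \<longrightarrow> norm (x t) < \<rho> \<longrightarrow> (x has_vector_derivative g (x t)) (at t)"
      proof (rule eventually_mono, intro impI)
        fix t assume "0 \<le> t" "norm (x t) < \<rho>"
          and "0 \<le> t \<longrightarrow> (\<exists>v. (m has_vector_derivative v) (at t) \<and> v \<in> Fmap Q r \<beta> (m t))"
        then obtain v where v: "(m has_vector_derivative v) (at t)" "v \<in> Fmap Q r \<beta> (m t)" by blast
        have "Dset Q r \<beta> (m t) = {d}"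
          using \<delta>2[OF simplex[OF \<open>0 \<le> t\<close>]] \<open>norm (x t) < \<rho>\<close> by (simp add: x_def \<rho>_def)
        then have "v = g (x t)" using v(2) by (simp add: Fmap_singleton g_def f_def x_def)
        then show "(x has_vector_derivative g (x t)) (at t)"
          using v(1) unfolding x_def by (auto intro!: derivative_eq_intros)
      qed
      show "K * b (x 0) (x 0) < \<rho>\<^sup>2" using init by (simp add: C_def)
    qed
    \<comment> \<open>Adding 1 keeps the constant positive for a trajectory that starts at the
      equilibrium, where \<open>C = 0\<close>.\<close>
    have "norm (m t - mbar) \<le> (sqrt C + 1) * exp (- c * t)" if "t \<ge> 0" for t
    proof (rule power2_le_imp_le)
      have "C \<le> (sqrt C + 1)\<^sup>2" using \<open>C \<ge> 0\<close> by (simp add: power2_sum)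
      then have "C * exp (- 2 * c * t) \<le> (sqrt C + 1)\<^sup>2 * exp (- 2 * c * t)" by (intro mult_right_mono) auto
      also have "\<dots> = ((sqrt C + 1) * exp (- c * t))\<^sup>2"
        by (simp add: power_mult_distrib flip: exp_double)
      finally show "(norm (m t - mbar))\<^sup>2 \<le> ((sqrt C + 1) * exp (- c * t))\<^sup>2"
        using decay[OF that] by (simp add: x_def)
    qed (use \<open>C \<ge> 0\<close> in auto)
    moreover have "sqrt C + 1 > 0" using \<open>C \<ge> 0\<close> by (simp add: add_nonneg_pos)
    ultimately show ?thesis using \<open>c > 0\<close> by blast
  qed
  then show ?thesis using \<open>\<delta> > 0\<close> by blast
qed

end
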